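(* Let $k \geq 3$ and let $H$ be a finite $k$-uniform hypergraph with $\nu^{(k-1)}(H) = 3$. Then $$\tau^{(k-1)}(H) \leq 3\left\lceil \frac{k+1}{2} \right\rceil.$$
   Context: For a $k$-uniform hypergraph $H$ with vertex set $V$ and $1 \le m \le k-1$: an $m$-matching of $H$ is a set $M$ of edges of $H$ such that $|e \cap e'| < m$ for all distinct $e, e' \in M$; $\nu^{(m)}(H)$ is the maximum size of an $m$-matching. An $m$-cover of $H$ is a set $C \subseteq \binom{V}{m}$ of $m$-subsets of $V$ such that every edge of $H$ contains some member of $C$; $\tau^{(m)}(H)$ is the minimum size of an $m$-cover. *)

theory Defs
  imports Complex_Main
begin

definition uniform_hypergraph :: "nat \<Rightarrow> 'a set \<Rightarrow> 'a set set \<Rightarrow> bool" where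
  "uniform_hypergraph k V E \<longleftrightarrow> (\<forall>e\<in>E. e \<subseteq> V \<and> finite e \<and> card e = k)"

definition m_matching :: "nat \<Rightarrow> 'a set set \<Rightarrow> 'a set set \<Rightarrow> bool" where
  "m_matching m E M \<longleftrightarrow>
     M \<subseteq> E \<and> (\<forall>e\<in>M. \<forall>e'\<in>M. e \<noteq> e' \<longrightarrow> card (e \<inter> e') < m)"

definition m_cover :: "nat \<Rightarrow> 'a set \<Rightarrow> 'a set set \<Rightarrow> 'a set set \<Rightarrow> bool" where
  "m_cover m V E C \<longleftrightarrow>
     C \<subseteq> {S. S \<subseteq> V \<and> finite S \<and> card S = m} \<and> (\<forall>e\<in>E. \<exists>S\<in>C. S \<subseteq> e)"

text \<open>
  The maximum and minimum below range over finite nonempty sets (and so are the intended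
  numbers) when the vertex set is finite and, for covers, \<open>m \<le> k\<close>; see the lemmas that follow.
\<close>

definition matching_number :: "nat \<Rightarrow> 'a set set \<Rightarrow> nat" where
  "matching_number m E = Max {card M | M. m_matching m E M}"

definition cover_number :: "nat \<Rightarrow> 'a set \<Rightarrow> 'a set set \<Rightarrow> nat" where
  "cover_number m V E = Min {card C | C. m_cover m V E C}"

lemma matching_sizes_finite_nonempty:
  assumes "finite V" "uniform_hypergraph k V E"
  shows "finite {card M | M. m_matching m E M}" "{card M | M. m_matching m E M} \<noteq> {}"
proof -
  have "E \<subseteq> Pow V"
    using assms(2) by (auto simp: uniform_hypergraph_def)
  then have "finite E"
    using assms(1) by (meson finite_Pow_iff finite_subset)
  then have "finite {M. m_matching m E M}"
    by (rule_tac finite_subset[of _ "Pow E"]) (auto simp: m_matching_def)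
  then show "finite {card M | M. m_matching m E M}"
    by simp
  have "m_matching m E {}"
    by (simp add: m_matching_def)
  then show "{card M | M. m_matching m E M} \<noteq> {}"
    by blast
qed

lemma cover_sizes_finite_nonempty:
  assumes "finite V" "uniform_hypergraph k V E" "m \<le> k"
  shows "finite {card C | C. m_cover m V E C}" "{card C | C. m_cover m V E C} \<noteq> {}"
proof -
  have "finite {C. m_cover m V E C}"
    using assms(1)
    by (rule_tac finite_subset[of _ "Pow (Pow V)"]) (auto simp: m_cover_def)
  then show "finite {card C | C. m_cover m V E C}"
    by simp
  have "\<exists>S. S \<subseteq> V \<and> finite S \<and> card S = m \<and> S \<subseteq> e" if "e \<in> E" for e
  proof -
    have "e \<subseteq> V" "card e = k"
      using assms(2) that by (auto simp: uniform_hypergraph_def)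
    moreover obtain S where "S \<subseteq> e" "card S = m" "finite S"
      using obtain_subset_with_card_n[of m e] assms(3) \<open>card e = k\<close> by metis
    ultimately show ?thesis
      by blast
  qed
  then have "m_cover m V E {S. S \<subseteq> V \<and> finite S \<and> card S = m}"
    by (auto simp: m_cover_def)
  then show "{card C | C. m_cover m V E C} \<noteq> {}"
    by blast
qed

end

theory Submission
  imports Defs
begin

text \<open>
  Write \<open>m = k - 1\<close> and \<open>h = (k + 2) div 2\<close>, which is the ceiling of \<open>(k + 1) / 2\<close>. Call two edges
  adjacent if they meet in \<open>k - 1\<close> vertices, independent if they meet in fewer, and near if they meet
  in exactly \<open>k - 2\<close>. Given a maximal independent triple \<open>a, b, c\<close>, every other edge is adjacent to
  exactly one member of it (private) or to at least two (common), and common neighbours exist only for near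
  pairs. The private neighbours of \<open>a\<close> together with \<open>a\<close> form a clique, which is either a star (one
  \<open>m\<close>-set suffices) or lies inside a set of \<open>k + 1\<close> vertices (\<open>h\<close> \<open>m\<close>-sets suffice, one of
  which may be an arbitrary \<open>m\<close>-subset of \<open>a\<close>).

  Choose the independent triple with as few near pairs as possible. Exchanging \<open>a\<close> for one of its
  private neighbours gives another independent triple, so minimality restricts the private
  neighbours. If there is at most one near pair, the free choices already cover the common
  neighbours. If there are at least two and \<open>k \<ge> 4\<close>, the private neighbours of an edge that is
  near both others need only \<open>h - 2\<close> \<open>m\<close>-sets, which leaves two \<open>m\<close>-subsets of each such edge for
  the common neighbours. For \<open>k = 3\<close> there is no such slack, and the possible intersection patterns
  of the three edges are inspected one by one.
\<close>

section \<open>Coverings by stars and by large simplices\<close>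

text \<open>Dropping \<open>u\<close> loses a point of \<open>g\<close> exactly when
  \<open>u\<close> lies in \<open>g\<close>, and adding \<open>w\<close> gains one likewise. Both
  changes are written as additions to avoid truncated subtraction.\<close>

lemma card_swap_Int:
  assumes "finite e" "u \<in> e" "w \<notin> e"
  shows "card (insert w (e - {u}) \<inter> g) + of_bool (u \<in> g) = card (e \<inter> g) + of_bool (w \<in> g)"
proof -
  have 1: "card (e \<inter> g) = card ((e - {u}) \<inter> g) + of_bool (u \<in> g)"
  proof (cases "u \<in> g")
    case True
    then have "e \<inter> g = insert u ((e - {u}) \<inter> g)"
      using assms(2) by auto
    then have "card (e \<inter> g) = card (insert u ((e - {u}) \<inter> g))"
      by simp
    then show ?thesis
      using True assms(1) by simp
  next
    case False
    then have "e \<inter> g = (e - {u}) \<inter> g"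
      by auto
    then show ?thesis
      using False by simp
  qed
  have 2: "card (insert w (e - {u}) \<inter> g) = card ((e - {u}) \<inter> g) + of_bool (w \<in> g)"
    using assms(1,3) by (auto simp: Int_insert_left)
  show ?thesis
    using 1 2 by simp
qed

locale uniform_family =
  fixes k :: nat and E :: "'a set set"
  assumes k3: "3 \<le> k"
    and finE: "finite E"
    and fin: "e \<in> E \<Longrightarrow> finite e"
    and card: "e \<in> E \<Longrightarrow> card e = k"
begin

definition adj :: "'a set \<Rightarrow> 'a set \<Rightarrow> bool" where
  "adj e f \<longleftrightarrow> Suc (card (e \<inter> f)) = k"

definition ind :: "'a set \<Rightarrow> 'a set \<Rightarrow> bool" where
  "ind e f \<longleftrightarrow> card (e \<inter> f) + 2 \<le> k"

definition near :: "'a set \<Rightarrow> 'a set \<Rightarrow> bool" where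
  "near e f \<longleftrightarrow> card (e \<inter> f) + 2 = k"

definition star :: "'a set \<Rightarrow> 'a set set" where
  "star S = {f. S \<subseteq> f}"

text \<open>
  Covering sets may have more than \<open>k - 1\<close> elements (shrinking them only helps), and \<open>F\<close> may be
  infinite, so that whole stars can be covered.
\<close>

definition cov :: "'a set set \<Rightarrow> nat \<Rightarrow> bool" where
  "cov F n \<longleftrightarrow> (\<exists>C. finite C \<and> card C \<le> n \<and> (\<forall>S\<in>C. k \<le> Suc (card S)) \<and> (\<forall>f\<in>F. \<exists>S\<in>C. S \<subseteq> f))"

definition h :: nat where
  "h = (k + 2) div 2"

lemma ind_sym: "ind e f \<longleftrightarrow> ind f e"
  by (simp add: ind_def Int_commute)

lemma near_sym: "near e f \<longleftrightarrow> near f e"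
  by (simp add: near_def Int_commute)

lemma trichotomy:
  assumes "e \<in> E" "f \<in> E"
  shows "e = f \<or> adj e f \<or> ind e f"
proof (cases "e = f")
  case False
  have "card (e \<inter> f) < k"
  proof (rule ccontr)
    assume "\<not> card (e \<inter> f) < k"
    then have "card e \<le> card (e \<inter> f)" "card f \<le> card (e \<inter> f)"
      using card assms by auto
    then have "e \<inter> f = e" "e \<inter> f = f"
      using fin assms by (metis card_seteq inf_le1, metis card_seteq inf_le2)
    then show False
      using False by auto
  qed
  then show ?thesis
    by (auto simp: adj_def ind_def)
qed simp

lemma not_ind_self: "e \<in> E \<Longrightarrow> \<not> ind e e"
  using card by (auto simp: ind_def)

lemma not_adj_ind: "adj e f \<Longrightarrow> \<not> ind e f"
  by (auto simp: adj_def ind_def)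

lemma adj_swap:
  assumes "e \<in> E" "f \<in> E" "adj f e"
  obtains u w where "u \<in> e" "w \<notin> e" "f = insert w (e - {u})"
proof -
  have fe: "finite e" "finite f" "card e = k" "card f = k"
    using assms fin card by auto
  have "card (e - f) = 1" "card (f - e) = 1"
    using fe assms(3) card_Diff_subset_Int[of e f] card_Diff_subset_Int[of f e]
    by (auto simp: adj_def Int_commute)
  then obtain u w where "e - f = {u}" "f - e = {w}"
    by (meson card_1_singletonE)
  then show thesis
    by (intro that[of u w]) auto
qed

lemma swap_adj:
  assumes "e \<in> E" "u \<in> e" "w \<notin> e"
  shows "adj (insert w (e - {u})) e"
  using card_swap_Int[of e u w e] assms fin card by (auto simp: adj_def)

lemma cov_mono: "cov F n \<Longrightarrow> G \<subseteq> F \<Longrightarrow> n \<le> m \<Longrightarrow> cov G m"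
  unfolding cov_def by (meson dual_order.trans subsetD)

lemma cov_subset:
  assumes "G \<subseteq> F" "cov F n"
  shows "cov G n"
  using cov_mono[OF assms(2,1) order_refl] .

lemma cov_Un:
  assumes "cov F n" "cov G m"
  shows "cov (F \<union> G) (n + m)"
proof -
  obtain C D where "finite C" "card C \<le> n" "\<forall>S\<in>C. k \<le> Suc (card S)" "\<forall>f\<in>F. \<exists>S\<in>C. S \<subseteq> f"
    "finite D" "card D \<le> m" "\<forall>S\<in>D. k \<le> Suc (card S)" "\<forall>f\<in>G. \<exists>S\<in>D. S \<subseteq> f"
    using assms unfolding cov_def by blast
  then show ?thesis
    unfolding cov_def
    by (intro exI[of _ "C \<union> D"] conjI)
      (auto intro: order_trans[OF card_Un_le] simp: Bex_def)
qed

lemma cov_star: "k \<le> Suc (card S) \<Longrightarrow> cov (star S) 1"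
  unfolding cov_def star_def by (intro exI[of _ "{S}"]) auto

lemma cov_star_Diff: "e \<in> E \<Longrightarrow> cov (star (e - {u})) 1"
  using fin[of e] card[of e] k3 by (intro cov_star) (auto simp: card_Diff_singleton_if)

text \<open>The members for \<open>u\<close> and \<open>v\<close> share the \<open>k - 1\<close>
  vertices of \<open>insert y (e - {u, v})\<close>, so the elements of \<open>W\<close> are paired
  off at one set per pair; an odd one out costs one more.\<close>

lemma cov_simplex:
  assumes "e \<in> E" "y \<notin> e" "W \<subseteq> e"
  shows "cov ((\<lambda>v. insert y (e - {v})) ` W) ((card W + 1) div 2)"
proof -
  have fW: "finite W"
    using assms fin finite_subset by blast
  show ?thesis
    using fW assms(3)
  proof (induction "card W" arbitrary: W rule: less_induct)
    case less
    consider "W = {}" | u where "W = {u}" | u v where "u \<in> W" "v \<in> W" "u \<noteq> v"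
      by auto
    then show ?case
    proof cases
      case 1
      then show ?thesis
        unfolding cov_def by auto
    next
      case 2
      have "cov (star (e - {u})) 1"
        using assms(1) by (rule cov_star_Diff)
      then show ?thesis
        using 2 by (auto intro: cov_mono simp: star_def)
    next
      case 3
      let ?W = "W - {u, v}"
      have c: "card W = card ?W + 2"
        using 3 less.prems(1) card_Diff_subset[of "{u,v}" W] card_mono[of W "{u,v}"] by simp
      have "cov ((\<lambda>v. insert y (e - {v})) ` ?W) ((card ?W + 1) div 2)"
        using less.prems c by (intro less.hyps) auto
      moreover have "cov (star (insert y (e - {u, v}))) 1"
      proof (rule cov_star)
        have "card (e - {u, v}) = k - 2"
          using 3 less.prems(2) fin[OF assms(1)] card[OF assms(1)] by (subst card_Diff_subset) auto
        then show "k \<le> Suc (card (insert y (e - {u, v})))"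
          using assms(1,2) fin by simp
      qed
      ultimately have "cov ((\<lambda>v. insert y (e - {v})) ` ?W \<union> star (insert y (e - {u, v})))
          ((card ?W + 1) div 2 + 1)"
        by (rule cov_Un)
      then show ?thesis
        by (rule cov_mono) (auto simp: star_def c)
    qed
  qed
qed

end

section \<open>Private and common neighbours of an independent triple\<close>

text \<open>\<open>no4\<close> is the bound of three on the matching number. Distinctness is
  implicit, since no edge is independent of itself.\<close>

locale no_four = uniform_family +
  assumes no4: "\<lbrakk>a \<in> E; b \<in> E; c \<in> E; d \<in> E; ind a b; ind a c; ind a d; ind b c; ind b d; ind c d\<rbrakk> \<Longrightarrow> False"
begin

definition trip :: "'a set \<Rightarrow> 'a set \<Rightarrow> 'a set \<Rightarrow> bool" where
  "trip a b c \<longleftrightarrow> a \<in> E \<and> b \<in> E \<and> c \<in> E \<and> ind a b \<and> ind a c \<and> ind b c"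

definition priv :: "'a set \<Rightarrow> 'a set \<Rightarrow> 'a set \<Rightarrow> 'a set set" where
  "priv a b c = {f \<in> E. adj f a \<and> ind f b \<and> ind f c}"

definition common :: "'a set \<Rightarrow> 'a set \<Rightarrow> 'a set set" where
  "common a b = {f \<in> E. adj f a \<and> adj f b}"

lemma trip_perm:
  "trip a b c \<Longrightarrow> trip b a c" "trip a b c \<Longrightarrow> trip a c b"
  by (auto simp: trip_def ind_sym)

lemma priv_commute: "priv a b c = priv a c b"
  by (auto simp: priv_def)

lemma common_commute: "common a b = common b a"
  by (auto simp: common_def)

lemma E_split:
  assumes "trip a b c"
  shows "E \<subseteq> {a, b, c} \<union> priv a b c \<union> priv b a c \<union> priv c a b \<union> common a b \<union> common a c \<union> common b c"
proof
  fix f assume f: "f \<in> E"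
  have "f = a \<or> adj f a \<or> ind f a" "f = b \<or> adj f b \<or> ind f b" "f = c \<or> adj f c \<or> ind f c"
    using trichotomy f assms by (auto simp: trip_def)
  moreover have "\<not> (ind f a \<and> ind f b \<and> ind f c)"
    using no4[of f a b c] f assms by (auto simp: trip_def)
  ultimately show "f \<in> {a, b, c} \<union> priv a b c \<union> priv b a c \<union> priv c a b \<union> common a b \<union> common a c \<union> common b c"
    using f by (auto simp: priv_def common_def)
qed

text \<open>Otherwise \<open>f\<close> and \<open>g\<close> would form four pairwise independent
  edges with \<open>b\<close> and \<open>c\<close>.\<close>

lemma priv_adj:
  assumes "trip a b c" "f \<in> priv a b c" "g \<in> priv a b c" "f \<noteq> g"
  shows "adj f g"
proof (rule ccontr)
  assume "\<not> adj f g"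
  then have "ind f g"
    using trichotomy[of f g] assms by (auto simp: priv_def)
  then show False
    using no4[of f g b c] assms by (auto simp: priv_def trip_def)
qed

text \<open>Each private neighbour exchanges some \<open>u\<close> in \<open>a\<close> for some
  \<open>w\<close> outside, and adjacency forces any two exchanges to agree in \<open>u\<close> or
  in \<open>w\<close>. If two of them differ in \<open>u\<close>, every exchange uses their common
  \<open>w\<close> (simplex); otherwise all use the same \<open>u\<close> (star).\<close>

lemma priv_cases:
  assumes "trip a b c"
  obtains (star) s where "s \<subseteq> a" "Suc (card s) = k" "priv a b c \<subseteq> star s"
  | (simplex) y U where "y \<notin> a" "U \<subseteq> a" "2 \<le> card U" "priv a b c = (\<lambda>v. insert y (a - {v})) ` U"
proof -
  have aE: "a \<in> E" and fa: "finite a" and ca: "card a = k"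
    using assms fin card by (auto simp: trip_def)
  have ex: "\<exists>u w. u \<in> a \<and> w \<notin> a \<and> f = insert w (a - {u})" if "f \<in> priv a b c" for f
    using that aE by (auto simp: priv_def elim!: adj_swap[of a f])
  have one: "u = u' \<or> w = w'"
    if "insert w (a - {u}) \<in> priv a b c" "insert w' (a - {u'}) \<in> priv a b c"
       "u \<in> a" "w \<notin> a" "u' \<in> a" "w' \<notin> a" for u w u' w'
  proof (rule ccontr)
    assume n: "\<not> (u = u' \<or> w = w')"
    have "card (insert w (a - {u}) \<inter> insert w' (a - {u'})) + of_bool (u \<in> insert w' (a - {u'}))
      = card (a \<inter> insert w' (a - {u'})) + of_bool (w \<in> insert w' (a - {u'}))"
      using card_swap_Int[OF fa that(3,4)] .
    moreover have "Suc (card (a \<inter> insert w' (a - {u'}))) = k"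
      using swap_adj[OF aE that(5,6)] by (simp add: adj_def Int_commute)
    ultimately have "\<not> adj (insert w (a - {u})) (insert w' (a - {u'}))"
      using n that by (auto simp: adj_def)
    moreover have "insert w (a - {u}) \<noteq> insert w' (a - {u'})"
      using n that by auto
    ultimately show False
      using priv_adj[OF assms that(1,2)] by blast
  qed
  show thesis
  proof (cases "\<exists>f\<in>priv a b c. \<exists>g\<in>priv a b c. \<exists>u\<in>a. \<exists>u'\<in>a. \<exists>w w'. w \<notin> a \<and> w' \<notin> a \<and> u \<noteq> u' \<and>
      f = insert w (a - {u}) \<and> g = insert w' (a - {u'})")
    case True
    then obtain u u' w w' where 1: "insert w (a - {u}) \<in> priv a b c" "insert w' (a - {u'}) \<in> priv a b c"
      "u \<in> a" "w \<notin> a" "u' \<in> a" "w' \<notin> a" "u \<noteq> u'"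
      by blast
    then have ww: "w = w'"
      using one by blast
    let ?U = "{v \<in> a. insert w (a - {v}) \<in> priv a b c}"
    have "{u, u'} \<subseteq> ?U"
      using 1 ww by auto
    then have "card {u, u'} \<le> card ?U"
      using fa by (intro card_mono) auto
    moreover have "f \<in> (\<lambda>v. insert w (a - {v})) ` ?U" if f: "f \<in> priv a b c" for f
    proof -
      obtain v x where vx: "v \<in> a" "x \<notin> a" "f = insert x (a - {v})"
        using ex[OF f] by blast
      then have "u = v \<or> w = x" "u' = v \<or> w' = x"
        using one 1 f by blast+
      \<comment> \<open>\<open>v\<close> cannot equal both \<open>u\<close> and \<open>u'\<close>,
        so it is the new vertex that agrees.\<close>
      then have "x = w"
        using 1(7) ww by auto
      then show ?thesis
        using vx f by auto
    qed
    ultimately show ?thesis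
      using simplex[of w ?U] 1 by auto
  next
    case False
    show ?thesis
    proof (cases "priv a b c = {}")
      case True
      \<comment> \<open>Without private neighbours any \<open>k - 1\<close> vertices of
        \<open>a\<close> serve as the star.\<close>
      obtain u where "u \<in> a"
        using ca k3 by fastforce
      then show ?thesis
        using star[of "a - {u}"] True fa ca k3 by (auto simp: star_def)
    next
      case nonempty: False
      then obtain f where f: "f \<in> priv a b c"
        by blast
      obtain u w where uw: "u \<in> a" "w \<notin> a" "f = insert w (a - {u})"
        using ex[OF f] by blast
      have "a - {u} \<subseteq> g" if g: "g \<in> priv a b c" for g
      proof -
        obtain u' w' where uw': "u' \<in> a" "w' \<notin> a" "g = insert w' (a - {u'})"
          using ex[OF g] by blast
        then have "u = u'"
          using False f g uw by blast
        then show ?thesis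
          using uw' by auto
      qed
      then show ?thesis
        using star[of "a - {u}"] uw fa ca k3 by (auto simp: star_def)
    qed
  qed
qed

section \<open>The shape of common neighbours\<close>

lemma near_Diff:
  assumes "a \<in> E" "b \<in> E" "near a b"
  obtains p p' where "a - b = {p, p'}" "p \<noteq> p'"
proof -
  have "card (a - b) = 2"
    using assms fin[of a] card[of a] card_Diff_subset_Int[of a b] by (auto simp: near_def)
  then show thesis
    using that by (meson card_2_iff)
qed

text \<open>One exchange raises the intersection with \<open>b\<close> by at most one. To get from
  at most \<open>k - 2\<close> up to \<open>k - 1\<close>, it must replace a vertex of
  \<open>a - b\<close> by one of \<open>b - a\<close>, starting from exactly \<open>k - 2\<close>.
  One vertex of \<open>a - b\<close> then remains.\<close>

lemma common_form:
  assumes "a \<in> E" "b \<in> E" "ind a b" "f \<in> common a b"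
  shows "near a b" "\<exists>p\<in>a - b. \<exists>q\<in>b - a. f = insert p (insert q (a \<inter> b))"
proof -
  have f: "f \<in> E" "adj f a" "adj f b"
    using assms(4) by (auto simp: common_def)
  obtain u w where uw: "u \<in> a" "w \<notin> a" "f = insert w (a - {u})"
    using adj_swap[OF assms(1) f(1,2)] .
  have "card (f \<inter> b) + of_bool (u \<in> b) = card (a \<inter> b) + of_bool (w \<in> b)"
    using card_swap_Int[OF fin[OF assms(1)] uw(1,2)] uw(3) by simp
  then have *: "u \<notin> b" "w \<in> b" and n: "near a b"
    using f(3) assms(3)
    by (cases "u \<in> b"; cases "w \<in> b"; auto simp: adj_def ind_def near_def)+
  show "near a b"
    by fact
  obtain p p' where p: "a - b = {p, p'}" "p \<noteq> p'"
    using near_Diff[OF assms(1,2) n] .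
  have "\<exists>r\<in>a - b. a - b = {u, r} \<and> u \<noteq> r"
    using p * uw by (metis DiffI insertE insert_commute insert_iff singletonD)
  then obtain r where r: "r \<in> a - b" "a - b = {u, r}" "u \<noteq> r"
    by blast
  then have "f = insert r (insert w (a \<inter> b))"
    using uw(3,1,2) * by blast
  then show "\<exists>p\<in>a - b. \<exists>q\<in>b - a. f = insert p (insert q (a \<inter> b))"
    using r(1) * uw by blast
qed

lemma common_far: "trip a b c \<Longrightarrow> \<not> near a b \<Longrightarrow> common a b = {}"
  using common_form(1)[of a b] by (auto simp: trip_def)

section \<open>Covering private and common neighbours with \<open>h\<close> sets\<close>

lemma h_ge_2: "2 \<le> h"
  using k3 by (auto simp: h_def)

text \<open>The prescribed set \<open>a - {u}\<close> is not wasted: in a simplex it covers the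
  exchange at \<open>u\<close>. At most \<open>k - 1\<close> exchanges remain, and
  \<open>1 + k div 2\<close> equals \<open>h\<close>.\<close>

lemma cov_priv_star:
  assumes "trip a b c" "u \<in> a"
  shows "cov (insert a (priv a b c \<union> star (a - {u}))) h"
proof -
  have a: "a \<in> E" "a \<in> star (a - {u})" "finite a" "card a = k"
    using assms fin card by (auto simp: trip_def star_def)
  have u: "cov (star (a - {u})) 1"
    using a by (intro cov_star_Diff)
  from assms(1) show ?thesis
  proof (cases rule: priv_cases)
    case (star s)
    have "cov (star s) 1"
      using star by (intro cov_star) auto
    with u have "cov (star (a - {u}) \<union> star s) (1 + 1)"
      by (rule cov_Un)
    then show ?thesis
      by (rule cov_mono) (use star a h_ge_2 in auto)
  next
    case (simplex y U)
    have "cov ((\<lambda>v. insert y (a - {v})) ` (U - {u})) ((card (U - {u}) + 1) div 2)"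
      using simplex a by (intro cov_simplex) auto
    then have "cov (star (a - {u}) \<union> (\<lambda>v. insert y (a - {v})) ` (U - {u})) (1 + (card (U - {u}) + 1) div 2)"
      using u by (rule cov_Un[rotated])
    moreover have "priv a b c \<subseteq> star (a - {u}) \<union> (\<lambda>v. insert y (a - {v})) ` (U - {u})"
      using simplex by (auto simp: star_def)
    moreover have "1 + (card (U - {u}) + 1) div 2 \<le> h"
    proof -
      have "card (U - {u}) \<le> card (a - {u})"
        using simplex a by (intro card_mono) auto
      then have "card (U - {u}) + 1 \<le> k"
        using a assms(2) k3 by simp
      then have "(card (U - {u}) + 1) div 2 \<le> k div 2"
        by (rule div_le_mono)
      then show ?thesis
        by (simp add: h_def)
    qed
    ultimately show ?thesis
      using a by (elim cov_mono) auto
  qed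
qed

lemma cov_priv:
  assumes "trip a b c"
  shows "cov (insert a (priv a b c)) h"
proof -
  have "a \<noteq> {}"
    using assms card[of a] k3 by (auto simp: trip_def)
  then obtain u where "u \<in> a"
    by blast
  then show ?thesis
    using cov_priv_star[OF assms, of u] by (auto elim: cov_mono)
qed

text \<open>If \<open>f\<close> were adjacent to \<open>c\<close>, it would be a common neighbour of
  \<open>b\<close> and \<open>c\<close>, which only near pairs have.\<close>

lemma common_ind_far:
  assumes "trip a b c" "\<not> near b c" "f \<in> common a b"
  shows "ind f c"
  using assms trichotomy[of f c] common_far[of b c a] not_adj_ind[of f b] trip_perm
  by (auto simp: trip_def common_def ind_sym)

text \<open>
  The common neighbours of \<open>a\<close> and \<open>b\<close> form a two-by-two grid. Half of it is covered at no extra cost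
  by the \<open>h\<close> sets spent on \<open>b\<close>; the set \<open>a - {u}\<close> covers the other half.
\<close>

lemma cov_one_sided:
  assumes t: "trip a b c" and n: "near a b" and far: "\<not> near b c"
  shows "\<exists>u\<in>a - b. cov (insert b (priv b a c \<union> {f \<in> common a b. u \<in> f})) h"
proof -
  have E: "a \<in> E" "b \<in> E" "c \<in> E" and i: "ind a b"
    using t by (auto simp: trip_def)
  have t': "trip b a c"
    using t trip_perm by blast
  obtain p p' where p: "a - b = {p, p'}" "p \<noteq> p'"
    using near_Diff[OF E(1,2) n] .
  obtain q q' where q: "b - a = {q, q'}" "q \<noteq> q'"
    using near_Diff[OF E(2,1)] n near_sym by blast
  let ?A = "a \<inter> b"
  let ?f = "\<lambda>r s. insert r (insert s ?A)"
  have pq: "p \<in> a" "p \<notin> b" "p' \<in> a" "p' \<notin> b" "q \<in> b" "q \<notin> a" "q' \<in> b" "q' \<notin> a"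
    using p(1) q(1) by blast+
  have cA: "card ?A + 2 = k" and fA: "finite ?A"
    using n fin E by (auto simp: near_def)
  have com: "\<exists>r\<in>{p, p'}. \<exists>s\<in>{q, q'}. f = ?f r s" if "f \<in> common a b" for f
    using common_form(2)[OF E(1,2) i that] p(1) q(1) by metis
  have Dq: "b - {q} = insert q' ?A" "b - {q'} = insert q ?A"
    using q by blast+
  show ?thesis
  proof (cases "\<forall>r\<in>{p, p'}. \<forall>s\<in>{q, q'}. ?f r s \<in> common a b")
    case False
    then obtain r s where rs: "r \<in> {p, p'}" "s \<in> {q, q'}" "?f r s \<notin> common a b"
      by blast
    \<comment> \<open>With the corner \<open>(r, s)\<close> missing from the grid, the row of
      \<open>r\<close> has at most one edge left, and it contains \<open>b - {s}\<close>.\<close>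
    have "{f \<in> common a b. r \<in> f} \<subseteq> star (b - {s})"
    proof
      fix f assume f: "f \<in> {f \<in> common a b. r \<in> f}"
      then obtain r' s' where rs': "r' \<in> {p, p'}" "s' \<in> {q, q'}" "f = ?f r' s'"
        using com by blast
      then have "r' = r"
        using f rs(1) pq q(1) p(2) by auto
      then have "s' \<noteq> s"
        using rs' rs f by auto
      then show "f \<in> star (b - {s})"
        using rs rs' q pq by (auto simp: star_def)
    qed
    moreover have "s \<in> b"
      using rs pq by auto
    ultimately show ?thesis
      using cov_priv_star[OF t', of s] rs(1) p by (intro bexI[of _ r]) (auto elim!: cov_mono)
  next
    case full: True
    have star1: "cov (star (insert r ?A)) 1" if "r \<notin> ?A" for r
      using cA fA that by (intro cov_star) simp
    from t' show ?thesis
    proof (cases rule: priv_cases)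
      case (star s)
      have "cov (star s) 1"
        using star by (intro cov_star) auto
      then have "cov (star s \<union> star (insert p ?A)) (1 + 1)"
        using star1[of p] pq by (intro cov_Un) auto
      moreover have "{f \<in> common a b. p \<in> f} \<subseteq> star (insert p ?A)"
        using com by (force simp: star_def)
      ultimately have "cov (insert b (priv b a c \<union> {f \<in> common a b. p \<in> f})) h"
        by (elim cov_mono) (use star h_ge_2 in \<open>auto simp: star_def\<close>)
      then show ?thesis
        using p by auto
    next
      case (simplex y U)
      have fU: "finite U"
        using simplex fin E finite_subset by blast
      show ?thesis
      proof (cases "y \<in> a")
        case True
        have y: "y \<in> {p, p'}"
          using True simplex p by blast
        have "U \<subseteq> ?A"
        proof
          \<comment> \<open>The exchange brings in a vertex of \<open>a\<close>; to stay independent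
            of \<open>a\<close> it must also remove one.\<close>
          fix v assume v: "v \<in> U"
          then have "insert y (b - {v}) \<in> priv b a c"
            using simplex by blast
          then have "ind (insert y (b - {v})) a"
            by (simp add: priv_def)
          moreover have "card (insert y (b - {v}) \<inter> a) + of_bool (v \<in> a) = card (b \<inter> a) + of_bool (y \<in> a)"
            using v simplex E fin by (intro card_swap_Int) auto
          ultimately have "v \<in> a"
            using True cA by (cases "v \<in> a") (auto simp: ind_def Int_commute)
          then show "v \<in> ?A"
            using v simplex by auto
        qed
        \<comment> \<open>The corner of \<open>y\<close> and \<open>q\<close> is itself the exchange
          of \<open>q'\<close> for \<open>y\<close>, so it joins the simplex. The corner of
          \<open>y\<close> and \<open>q'\<close> is left to the star of
          \<open>insert q' ?A\<close>.\<close>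
        let ?F = "(\<lambda>v. insert y (b - {v})) ` (insert q' U)"
        have "card (insert q' U) \<le> k - 1"
          using card_mono[OF fA \<open>U \<subseteq> ?A\<close>] cA fU card_insert_if[OF fU, of q'] by auto
        then have "(card (insert q' U) + 1) div 2 \<le> k div 2"
          using k3 by (intro div_le_mono) auto
        moreover have "cov (star (insert q' ?A) \<union> ?F) (1 + (card (insert q' U) + 1) div 2)"
          using simplex E star1[of q'] pq by (intro cov_Un cov_simplex) auto
        moreover have "{f \<in> common a b. y \<in> f} \<subseteq> star (insert q' ?A) \<union> ?F"
        proof
          fix f assume f: "f \<in> {f \<in> common a b. y \<in> f}"
          then obtain r' s' where rs': "r' \<in> {p, p'}" "s' \<in> {q, q'}" "f = ?f r' s'"
            using com by blast
          then have "r' = y"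
            using f y pq q(1) p(2) by auto
          then show "f \<in> star (insert q' ?A) \<union> ?F"
            using rs' Dq by (auto simp: star_def)
        qed
        moreover have "b \<in> star (insert q' ?A)"
          using pq by (auto simp: star_def)
        ultimately have "cov (insert b (priv b a c \<union> {f \<in> common a b. y \<in> f})) h"
          using simplex(4) by (elim cov_mono) (auto simp: h_def)
        then show ?thesis
          using y p by auto
      next
        case y: False
        show ?thesis
        proof (cases "U \<subseteq> {q, q'}")
          case True
          \<comment> \<open>These two sets are \<open>b - {q'}\<close> and \<open>b - {q}\<close>;
            they cover the whole grid and both possible exchanges.\<close>
          have "cov (star (insert q ?A) \<union> star (insert q' ?A)) (1 + 1)"
            using star1 pq by (intro cov_Un) auto
          moreover have "common a b \<subseteq> star (insert q ?A) \<union> star (insert q' ?A)"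
            using com by (force simp: star_def)
          moreover have "priv b a c \<subseteq> star (insert q ?A) \<union> star (insert q' ?A)"
            using True Dq unfolding simplex(4) by (auto simp: star_def)
          moreover have "b \<in> star (insert q ?A)"
            using pq by (auto simp: star_def)
          ultimately have "cov (insert b (priv b a c \<union> {f \<in> common a b. p \<in> f})) h"
            using h_ge_2 by (elim cov_mono) auto
          then show ?thesis
            using p by auto
        next
          case False
          then obtain v where v: "v \<in> U" "v \<in> a" "v \<in> b"
            using simplex q by blast
          \<comment> \<open>This edge, \<open>c\<close> and two opposite corners of the full grid
            are four pairwise independent edges. A corner meets \<open>?g\<close> in only
            \<open>k - 2\<close> vertices because \<open>v\<close> is lost and \<open>y\<close> is
            outside \<open>a\<close>.\<close>
          let ?g = "insert y (b - {v})"
          have g: "?g \<in> priv b a c"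
            using v simplex by blast
          have "ind (?f r s) ?g" if "r \<in> {p, p'}" "s \<in> {q, q'}" for r s
          proof -
            have rs: "r \<in> a" "r \<notin> b" "s \<in> b" "s \<notin> a"
              using that pq by auto
            then have "?f r s \<inter> ?g = insert s (?A - {v})"
              using y v simplex by blast
            moreover have "card (insert s (?A - {v})) = card ?A"
              using rs v fA card_Suc_Diff1[of ?A v] by (auto simp: card_insert_if)
            ultimately show ?thesis
              using cA by (simp add: ind_def)
          qed
          moreover have "?f p q \<inter> ?f p' q' = ?A"
            using pq p(2) q(2) by blast
          then have "ind (?f p q) (?f p' q')"
            using cA by (simp add: ind_def)
          moreover have "ind (?f p q) c" "ind (?f p' q') c"
            using common_ind_far[OF t far] full by auto
          moreover have "?f p q \<in> E" "?f p' q' \<in> E" "?g \<in> E" "ind ?g c"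
            using full g by (auto simp: common_def priv_def)
          ultimately have False
            using no4[of "?f p q" "?f p' q'" ?g c] E by auto
          then show ?thesis ..
        qed
      qed
    qed
  qed
qed

section \<open>Covers of the whole family by the number of near pairs\<close>

lemma cov_no_near:
  assumes t: "trip a b c" and far: "\<not> near a b" "\<not> near a c" "\<not> near b c"
  shows "cov E (3 * h)"
proof -
  have 1: "trip b a c" "trip c a b" "trip a c b" "trip b c a"
    using t trip_perm by blast+
  have "cov (insert a (priv a b c) \<union> insert b (priv b a c) \<union> insert c (priv c a b)) (h + h + h)"
    using t 1 by (intro cov_Un cov_priv)
  then show ?thesis
    using E_split[OF t] common_far[OF t far(1)] common_far[OF 1(3) far(2)] common_far[OF 1(4) far(3)]
    by (elim cov_mono) auto
qed

text \<open>A common neighbour contains one of the two vertices of \<open>a - b\<close> and all of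
  \<open>a \<inter> b\<close>; if it misses \<open>u\<close>, this makes up
  \<open>a - {u}\<close>.\<close>

lemma common_half:
  assumes "trip a b c" "u \<in> a - b"
  shows "{f \<in> common a b. u \<notin> f} \<subseteq> star (a - {u})"
proof
  fix f assume f: "f \<in> {f \<in> common a b. u \<notin> f}"
  have E: "a \<in> E" "b \<in> E" "ind a b"
    using assms by (auto simp: trip_def)
  have n: "near a b" and "\<exists>p\<in>a - b. \<exists>q\<in>b - a. f = insert p (insert q (a \<inter> b))"
    using common_form[OF E] f by auto
  then obtain p q where pq: "p \<in> a - b" "q \<in> b - a" "f = insert p (insert q (a \<inter> b))"
    by blast
  obtain r r' where "a - b = {r, r'}"
    using near_Diff[OF E(1,2) n] .
  moreover have "p \<noteq> u"
    using f pq by auto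
  ultimately have "a - b = {u, p}"
    using pq assms(2) by auto
  then show "f \<in> star (a - {u})"
    using pq by (auto simp: star_def)
qed

text \<open>The sets spent on \<open>b\<close> cover the half of the grid containing
  \<open>u\<close>, and the free choice among those spent on \<open>a\<close> is
  \<open>a - {u}\<close>, which covers the other half.\<close>

lemma cov_one_near:
  assumes t: "trip a b c" and n: "near a b" and far: "\<not> near a c" "\<not> near b c"
  shows "cov E (3 * h)"
proof -
  have 1: "trip c a b" "trip a c b" "trip b c a"
    using t trip_perm by blast+
  obtain u where u: "u \<in> a - b" "cov (insert b (priv b a c \<union> {f \<in> common a b. u \<in> f})) h"
    using cov_one_sided[OF t n far(2)] by blast
  have "cov (insert b (priv b a c \<union> {f \<in> common a b. u \<in> f}) \<union> insert a (priv a b c \<union> star (a - {u}))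
      \<union> insert c (priv c a b)) (h + h + h)"
    using u 1 t by (intro cov_Un cov_priv cov_priv_star) auto
  moreover have "common a b \<subseteq> {f \<in> common a b. u \<in> f} \<union> star (a - {u})"
    using common_half[OF t u(1)] by blast
  ultimately show ?thesis
    using E_split[OF t] common_far[OF 1(2) far(1)] common_far[OF 1(3) far(2)]
    by (elim cov_mono) auto
qed

text \<open>An exchange preserves the size of the intersection with \<open>b\<close> only if it
  trades inside \<open>b\<close> or outside \<open>b\<close>.\<close>

lemma simplex_near:
  assumes "a \<in> E" "near a b" "y \<notin> a" "v \<in> a" "near (insert y (a - {v})) b"
  shows "v \<in> b \<longleftrightarrow> y \<in> b"
  using card_swap_Int[of a v y b] assms fin
  by (cases "v \<in> b"; cases "y \<in> b"; auto simp: near_def)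

text \<open>By \<open>simplex_near\<close>, the apex \<open>y\<close> and all exchanged vertices
  agree on membership in \<open>b\<close> and in \<open>c\<close>. Either they all lie in
  \<open>b \<inter> c\<close>, which has at most \<open>k - 2\<close> vertices, or the exchanged
  ones lie in the two-element set \<open>a - b\<close> or \<open>a - c\<close>.\<close>

lemma cov_priv_small:
  assumes k4: "4 \<le> k" and t: "trip a b c" and n: "near a b" "near a c"
    and np: "\<And>f. f \<in> priv a b c \<Longrightarrow> near f b \<and> near f c"
  shows "cov (priv a b c) (h - 2)"
proof -
  have E: "a \<in> E" "b \<in> E" "c \<in> E" "ind b c"
    using t by (auto simp: trip_def)
  \<comment> \<open>Here \<open>k\<close> must be at least 4: for \<open>k = 3\<close> the value
    \<open>h - 2\<close> is 0 and not even a star would fit.\<close>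
  have h: "1 \<le> h - 2" "h - 2 = (k - 2) div 2"
    using k4 by (auto simp: h_def)
  from t show ?thesis
  proof (cases rule: priv_cases)
    case (star s)
    then have "cov (star s) 1"
      by (intro cov_star) auto
    then show ?thesis
      using star(3) h(1) by (rule cov_mono)
  next
    case (simplex y U)
    have fU: "finite U"
      using simplex fin E finite_subset by blast
    have yb: "v \<in> b \<longleftrightarrow> y \<in> b" and yc: "v \<in> c \<longleftrightarrow> y \<in> c" if "v \<in> U" for v
    proof -
      have "v \<in> a" "insert y (a - {v}) \<in> priv a b c"
        using that simplex by blast+
      then show "v \<in> b \<longleftrightarrow> y \<in> b" "v \<in> c \<longleftrightarrow> y \<in> c"
        using simplex_near[OF E(1) n(1) simplex(1)] simplex_near[OF E(1) n(2) simplex(1)] np by blast+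
    qed
    have "(card U + 1) div 2 \<le> h - 2"
    proof (cases "y \<in> b \<and> y \<in> c")
      case True
      then have "insert y U \<subseteq> b \<inter> c"
        using yb yc by blast
      then have "card (insert y U) \<le> card (b \<inter> c)"
        using fin E by (intro card_mono) auto
      moreover have "y \<notin> U"
        using simplex by blast
      ultimately have "card U + 1 \<le> k - 2"
        using fU E(4) by (simp add: ind_def)
      then show ?thesis
        unfolding h(2) by (rule div_le_mono)
    next
      case False
      have "card U \<le> 2"
      proof -
        have "U \<subseteq> a - b \<or> U \<subseteq> a - c"
          using False yb yc simplex by blast
        moreover obtain p p' where "a - b = {p, p'}" "p \<noteq> p'"
          using near_Diff[OF E(1,2) n(1)] .
        moreover obtain q q' where "a - c = {q, q'}" "q \<noteq> q'"
          using near_Diff[OF E(1,3) n(2)] .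
        ultimately obtain z z' where "U \<subseteq> {z, z'}" "z \<noteq> z'"
          by metis
        then show ?thesis
          using card_mono[of "{z, z'}" U] by simp
      qed
      then show ?thesis
        using h(1) by simp
    qed
    moreover have "cov (priv a b c) ((card U + 1) div 2)"
      unfolding simplex(4) using simplex E by (intro cov_simplex)
    ultimately show ?thesis
      by (elim cov_mono) auto
  qed
qed

lemma cov_two_near:
  assumes k4: "4 \<le> k" and t: "trip a b c" and n: "near a b" "near a c" and far: "\<not> near b c"
    and np: "\<And>f. f \<in> priv a b c \<Longrightarrow> near f b \<and> near f c"
  shows "cov E (3 * h)"
proof -
  have 1: "trip a c b" "trip b c a"
    using t trip_perm by blast+
  have aE: "a \<in> E"
    using t by (auto simp: trip_def)
  obtain u where u: "u \<in> a - b" "cov (insert b (priv b a c \<union> {f \<in> common a b. u \<in> f})) h"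
    using cov_one_sided[OF t n(1) far] by blast
  obtain v where v: "v \<in> a - c" "cov (insert c (priv c a b \<union> {f \<in> common a c. v \<in> f})) h"
    using cov_one_sided[OF 1(1) n(2)] far near_sym by blast
  \<comment> \<open>The edges \<open>b\<close> and \<open>c\<close> each pay for half of their grid
    with \<open>a\<close>; the two sets saved on \<open>a\<close> pay for the other halves.\<close>
  have "cov (insert b (priv b a c \<union> {f \<in> common a b. u \<in> f}) \<union> insert c (priv c a b \<union> {f \<in> common a c. v \<in> f})
      \<union> priv a b c \<union> star (a - {u}) \<union> star (a - {v})) (h + h + (h - 2) + 1 + 1)"
    using u v aE cov_priv_small[OF k4 t n np] by (intro cov_Un cov_star_Diff) auto
  moreover have "h + h + (h - 2) + 1 + 1 = 3 * h"
    using h_ge_2 by simp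
  moreover have "common a b \<subseteq> {f \<in> common a b. u \<in> f} \<union> star (a - {u})"
    using common_half[OF t u(1)] by blast
  moreover have "common a c \<subseteq> {f \<in> common a c. v \<in> f} \<union> star (a - {v})"
    using common_half[OF 1(1) v(1)] by blast
  moreover have "a \<in> star (a - {u})"
    by (auto simp: star_def)
  ultimately show ?thesis
    using E_split[OF t] common_far[OF 1(2) far]
    by (elim cov_mono) auto
qed

text \<open>Each common neighbour misses exactly one of the two vertices of \<open>a - b\<close>, so
  the two sets obtained from \<open>a\<close> by deleting such a vertex suffice.\<close>

lemma cov_common:
  assumes "trip a b c" "near a b"
  shows "cov (insert a (common a b)) 2"
proof -
  have E: "a \<in> E" "b \<in> E"
    using assms by (auto simp: trip_def)
  obtain p p' where p: "a - b = {p, p'}" "p \<noteq> p'"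
    using near_Diff[OF E assms(2)] .
  have "cov (star (a - {p}) \<union> star (a - {p'})) (1 + 1)"
    using E by (intro cov_Un cov_star_Diff)
  moreover have "common a b \<subseteq> star (a - {p}) \<union> star (a - {p'})"
  proof
    fix f assume "f \<in> common a b"
    then obtain r q where "r \<in> a - b" "f = insert r (insert q (a \<inter> b))"
      using common_form(2)[OF E, of f] assms(1) unfolding trip_def by blast
    then show "f \<in> star (a - {p}) \<union> star (a - {p'})"
      using p by (auto simp: star_def)
  qed
  ultimately show ?thesis
    by (elim cov_mono) (auto simp: star_def)
qed

lemma cov_three_near:
  assumes k4: "4 \<le> k" and t: "trip a b c" and n: "near a b" "near a c" "near b c"
    and np: "\<And>x y z. trip x y z \<Longrightarrow> near x y"
  shows "cov E (3 * h)"
proof -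
  have 1: "trip b a c" "trip c a b" "trip b c a"
    using t trip_perm by blast+
  have small: "cov (priv x y z) (h - 2)" if "trip x y z" for x y z
  proof (rule cov_priv_small[OF k4 that])
    show "near x y" "near x z"
      using np that trip_perm by blast+
    fix f assume "f \<in> priv x y z"
    then have "trip f y z"
      using that by (auto simp: trip_def priv_def)
    then show "near f y \<and> near f z"
      using np trip_perm by blast
  qed
  \<comment> \<open>Every edge saves two sets on its private neighbours, and these pay for one of
    the three grids; the grids are assigned cyclically.\<close>
  have "cov (priv a b c \<union> priv b a c \<union> priv c a b \<union> insert a (common a b) \<union> insert b (common b c)
     \<union> insert c (common c a)) ((h - 2) + (h - 2) + (h - 2) + 2 + 2 + 2)"
    using small t 1 n near_sym by (intro cov_Un cov_common[of _ _ a] cov_common[of _ _ b] cov_common[of _ _ c]) auto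
  moreover have "(h - 2) + (h - 2) + (h - 2) + 2 + 2 + 2 = 3 * h"
    using h_ge_2 by simp
  ultimately show ?thesis
    using E_split[OF t] by (elim cov_mono) (auto simp: common_commute)
qed

end

section \<open>Families of triples\<close>

text \<open>
  \<open>Q\<close> collects the possible common neighbours of the edges \<open>xbc\<close>, \<open>yac\<close>, \<open>zab\<close>. Whichever pair is
  prescribed in each of these edges, one of seven fixed choices of three further pairs completes a cover.
\<close>

lemma triangle_cover:
  fixes a b c x y z :: 'a
  assumes d: "distinct [a, b, c, x, y, z]"
    and s: "s1 = {b, c} \<or> s1 = {x, c} \<or> s1 = {x, b}" "s2 = {a, c} \<or> s2 = {y, c} \<or> s2 = {y, a}"
      "s3 = {a, b} \<or> s3 = {z, b} \<or> s3 = {z, a}"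
  defines "Q \<equiv> {{a, b, c}, {c, x, y}, {c, x, a}, {c, b, y}, {b, x, z}, {b, x, a}, {b, c, z}, {a, y, z}, {a, y, b}, {a, c, z}}"
  obtains (witness) t1 t2 t3 where "card t1 = 2" "card t2 = 2" "card t3 = 2"
    "\<forall>f\<in>Q. s1 \<subseteq> f \<or> s2 \<subseteq> f \<or> s3 \<subseteq> f \<or> t1 \<subseteq> f \<or> t2 \<subseteq> f \<or> t3 \<subseteq> f"
proof -
  define P where "P t1 t2 t3 \<longleftrightarrow>
    (\<forall>f\<in>Q. s1 \<subseteq> f \<or> s2 \<subseteq> f \<or> s3 \<subseteq> f \<or> t1 \<subseteq> f \<or> t2 \<subseteq> f \<or> t3 \<subseteq> f)" for t1 t2 t3
  \<comment> \<open>A finite check over the 27 combinations of prescribed pairs.\<close>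
  have "P {a, b} {a, z} {c, x} \<or> P {a, b} {b, z} {c, x} \<or> P {a, c} {b, z} {c, y} \<or> P {a, y} {b, z} {c, y}
      \<or> P {a, c} {a, y} {b, z} \<or> P {a, y} {b, c} {b, x} \<or> P {a, b} {a, c} {b, c}"
    using s d unfolding P_def Q_def by (elim disjE) simp_all
  moreover have "card {a, b} = 2" "card {a, z} = 2" "card {c, x} = 2" "card {b, z} = 2" "card {a, c} = 2"
    "card {c, y} = 2" "card {a, y} = 2" "card {b, c} = 2" "card {b, x} = 2"
    using d by auto
  moreover have "thesis" if "P t1 t2 t3" "card t1 = 2" "card t2 = 2" "card t3 = 2" for t1 t2 t3
    using witness[OF that(2-4)] that(1) unfolding P_def by simp
  ultimately show thesis
    by (elim disjE) metis+
qed

text \<open>Here covering sets can be taken to be pairs, independence means at most one common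
  vertex, and the target \<open>3 * h\<close> is 6.\<close>

locale no_four_triples = no_four +
  assumes k: "k = 3"
begin

lemma h_eq: "h = 2"
  unfolding h_def using k by simp

lemma cov_pair: "card S = 2 \<Longrightarrow> cov (star S) 1"
  by (intro cov_star) (simp add: k)

lemma near_singleton:
  assumes "near a b"
  obtains v where "a \<inter> b = {v}"
proof -
  have "card (a \<inter> b) = 1"
    using assms k unfolding near_def by simp
  then show thesis
    using that by (meson card_1_singletonE)
qed

lemma near_iff: "near a b \<longleftrightarrow> card (a \<inter> b) = 1"
  unfolding near_def using k by auto

section \<open>Triples with three near pairs: sunflowers and triangles\<close>

text \<open>Every edge contains the centre \<open>v\<close> and one of the six other vertices of the
  sunflower, so the six pairs joining \<open>v\<close> to these form a cover.\<close>

lemma cov_sunflower: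
  assumes t: "trip p q r" and v: "p \<inter> q = {v}" "p \<inter> r = {v}" "q \<inter> r = {v}"
    and np: "\<And>a b c. trip a b c \<Longrightarrow> near a b"
  shows "cov E 6"
proof -
  let ?W = "(p - {v}) \<union> (q - {v}) \<union> (r - {v})"
  have E: "p \<in> E" "q \<in> E" "r \<in> E"
    using t by (auto simp: trip_def)
  have cW: "card (a - {v}) = 2" if "a \<in> {p, q, r}" for a
  proof -
    have "a \<in> E" "v \<in> a"
      using that v E by blast+
    then show ?thesis
      using card[of a] fin[of a] k by (simp add: card_Diff_singleton)
  qed
  have fW: "finite ?W"
    using E fin by auto
  have "card ?W \<le> 2 + 2 + 2"
    using cW by (intro order_trans[OF card_Un_le] add_mono) auto
  have core: "\<exists>u\<in>a. u \<noteq> v \<and> {v, u} \<subseteq> f"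
    if t': "trip a b c" and w: "a \<inter> b = {v}" "a \<inter> c = {v}" "b \<inter> c = {v}"
      and f: "f \<in> insert a (priv a b c \<union> common a b \<union> common a c)" for a b c f
  proof -
    have aE: "a \<in> E" "b \<in> E" "c \<in> E" and i: "ind a b" "ind a c"
      using t' by (auto simp: trip_def)
    have "v \<in> a"
      using w by blast
    then have ca: "card (a - {v}) = 2" "v \<in> a"
      using aE card[of a] fin[of a] k by (simp_all add: card_Diff_singleton)
    then have ex: "\<exists>u\<in>a. u \<noteq> v \<and> u \<noteq> u'" for u'
      by (metis (no_types, lifting) DiffD1 DiffD2 card_2_iff insertCI insert_Diff_single insert_iff singletonI)
    consider "f = a" | "f \<in> priv a b c" | d where "d = b \<or> d = c" "f \<in> common a d"
      using f by blast
    then show ?thesis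
    proof cases
      case 1
      then show ?thesis
        using ex ca by blast
    next
      case 2
      then have fE: "f \<in> E" "adj f a" and tf: "trip f b c"
        using t' by (auto simp: priv_def trip_def)
      have n: "near f b" "near f c" "near a b" "near a c"
        using np tf t' trip_perm by blast+
      obtain u w where uw: "u \<in> a" "w \<notin> a" "f = insert w (a - {u})"
        using adj_swap[OF aE(1) fE] .
      have "u \<in> b \<longleftrightarrow> w \<in> b" "u \<in> c \<longleftrightarrow> w \<in> c"
        using simplex_near[OF aE(1) n(3) uw(2,1)] simplex_near[OF aE(1) n(4) uw(2,1)] n uw(3) by blast+
      \<comment> \<open>If the centre were removed, the new vertex would lie in both
        \<open>b\<close> and \<open>c\<close>, hence be the centre again.\<close>
      then have "u \<noteq> v"
        using w uw by auto
      then show ?thesis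
        using ex[of u] uw ca by auto
    next
      case 3
      then have "a \<inter> d = {v}" "ind a d" "d \<in> E"
        using w i aE by auto
      then obtain u u' where "u \<in> a - d" "f = insert u (insert u' {v})"
        using common_form(2)[OF aE(1), of d f] 3(2) by metis
      then show ?thesis
        using ca(2) \<open>a \<inter> d = {v}\<close> by (intro bexI[of _ u]) auto
    qed
  qed
  have "\<exists>u\<in>?W. {v, u} \<subseteq> f" if f: "f \<in> E" for f
  proof -
    have 1: "trip q p r" "trip r p q"
      using t trip_perm by blast+
    have v': "q \<inter> p = {v}" "r \<inter> p = {v}" "r \<inter> q = {v}"
      using v by auto
    have "f \<in> insert p (priv p q r \<union> common p q \<union> common p r) \<or> f \<in> insert q (priv q p r \<union> common q p \<union> common q r)
       \<or> f \<in> insert r (priv r p q \<union> common r p \<union> common r q)"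
      using E_split[OF t] f by blast
    then have "\<exists>a\<in>{p, q, r}. \<exists>u\<in>a. u \<noteq> v \<and> {v, u} \<subseteq> f"
    proof (elim disjE)
      assume "f \<in> insert p (priv p q r \<union> common p q \<union> common p r)"
      from core[OF t v this] show ?thesis by simp
    next
      assume "f \<in> insert q (priv q p r \<union> common q p \<union> common q r)"
      from core[OF 1(1) v'(1) v(3) v(2) this] show ?thesis by simp
    next
      assume "f \<in> insert r (priv r p q \<union> common r p \<union> common r q)"
      from core[OF 1(2) v'(2,3) v(1) this] show ?thesis by simp
    qed
    then show ?thesis
      by auto
  qed
  moreover have "card ((\<lambda>u. {v, u}) ` ?W) \<le> 6"
    using \<open>card ?W \<le> 2 + 2 + 2\<close> card_image_le[OF fW, of "\<lambda>u. {v, u}"] by linarith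
  ultimately show ?thesis
    unfolding cov_def using fW k by (intro exI[of _ "(\<lambda>u. {v, u}) ` ?W"]) (auto simp: card_insert_if)
qed

lemma center_form:
  assumes "e1 \<in> E" "e1 \<inter> e2 = {c}" "e1 \<inter> e3 = {b}" "b \<noteq> c"
  obtains x where "e1 = {x, b, c}" "x \<notin> e2" "x \<notin> e3" "b \<notin> e2" "c \<notin> e3" "x \<noteq> b" "x \<noteq> c"
proof -
  have "card (e1 - {b, c}) = 1"
    using assms card[of e1] fin[of e1] k by (subst card_Diff_subset) auto
  then obtain x where x: "e1 - {b, c} = {x}"
    by (meson card_1_singletonE)
  show thesis
  proof (rule that[of x])
    have bc: "b \<in> e1" "c \<in> e1" "b \<in> e3" "c \<in> e2"
      using assms by blast+
    then show e: "e1 = {x, b, c}"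
      using x by blast
    have "x \<in> e1 - {b, c}"
      using x by simp
    then show "x \<notin> e2" "x \<notin> e3" "x \<noteq> b" "x \<noteq> c"
      using assms(2,3) by blast+
    show "b \<notin> e2" "c \<notin> e3"
      using bc assms(2-4) by (metis IntI singletonD)+
  qed
qed

text \<open>The three vertices of \<open>e1\<close> have different membership patterns in
  \<open>e2\<close> and \<open>e3\<close>, whereas all exchanges in a simplex must share the pattern
  of the apex. This leaves at most one exchange, so only the star case survives.\<close>

lemma priv_star:
  assumes t: "trip e1 e2 e3" and i: "e1 \<inter> e2 = {c}" "e1 \<inter> e3 = {b}" "e1 = {x, b, c}" "b \<noteq> c"
    and np: "\<And>f. f \<in> priv e1 e2 e3 \<Longrightarrow> near f e2 \<and> near f e3"
  obtains s where "s = {b, c} \<or> s = {x, c} \<or> s = {x, b}" "priv e1 e2 e3 \<subseteq> star s"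
proof -
  have E: "e1 \<in> E"
    using t by (auto simp: trip_def)
  have n: "near e1 e2" "near e1 e3"
    using i by (auto simp: near_iff)
  from t show thesis
  proof (cases rule: priv_cases)
    case (star s)
    then have "card s = 2" "s \<subseteq> {x, b, c}"
      using k i by auto
    then have "s = {b, c} \<or> s = {x, c} \<or> s = {x, b}"
      by (auto simp: card_2_iff)
    then show ?thesis
      using star that by blast
  next
    case (simplex y U)
    have *: "v \<in> e2 \<longleftrightarrow> y \<in> e2" "v \<in> e3 \<longleftrightarrow> y \<in> e3" if "v \<in> U" for v
    proof -
      have "v \<in> e1" "insert y (e1 - {v}) \<in> priv e1 e2 e3"
        using that simplex by blast+
      then show "v \<in> e2 \<longleftrightarrow> y \<in> e2" "v \<in> e3 \<longleftrightarrow> y \<in> e3"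
        using simplex_near[OF E n(1) simplex(1)] simplex_near[OF E n(2) simplex(1)] np by blast+
    qed
    have "v = v'" if "v \<in> U" "v' \<in> U" for v v'
    proof -
      have "v \<in> e2 \<longleftrightarrow> v' \<in> e2" "v \<in> e3 \<longleftrightarrow> v' \<in> e3"
        using *[OF that(1)] *[OF that(2)] by simp_all
      moreover have "v \<in> {x, b, c}" "v' \<in> {x, b, c}"
        using that simplex(2) i(3) by auto
      moreover have "w \<in> e2 \<longleftrightarrow> w = c" "w \<in> e3 \<longleftrightarrow> w = b" if "w \<in> {x, b, c}" for w
        using i(1,2) that unfolding i(3) by (auto simp: set_eq_iff)
      ultimately show ?thesis
        by auto
    qed
    moreover have "finite U"
      using fin[OF E] simplex(2) finite_subset by blast
    ultimately have "card U \<le> 1"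
      by (simp add: card_le_Suc0_iff_eq)
    then show ?thesis
      using simplex(3) by simp
  qed
qed

lemma common_subset:
  assumes "trip e1 e2 e3" "e1 \<inter> e2 = {c}" "e1 - e2 = {p, p'}" "e2 - e1 = {q, q'}"
  shows "common e1 e2 \<subseteq> {{c, p, q}, {c, p, q'}, {c, p', q}, {c, p', q'}}"
proof
  fix f assume f: "f \<in> common e1 e2"
  have "e1 \<in> E" "e2 \<in> E" "ind e1 e2"
    using assms by (auto simp: trip_def)
  then obtain r s where "r \<in> e1 - e2" "s \<in> e2 - e1" "f = insert r (insert s {c})"
    using common_form(2)[of e1 e2 f] f assms(2) by metis
  then have "r \<in> {p, p'}" "s \<in> {q, q'}" "f = {c, r, s}"
    unfolding assms(3,4) by (simp_all add: insert_commute)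
  then show "f \<in> {{c, p, q}, {c, p, q'}, {c, p', q}, {c, p', q'}}"
    by auto
qed

text \<open>One pair per edge covers that edge and its private neighbours;
  \<open>triangle_cover\<close> supplies three more pairs for the common neighbours.\<close>

lemma cov_triangle:
  assumes t: "trip e1 e2 e3" and i: "e1 \<inter> e2 = {c}" "e1 \<inter> e3 = {b}" "e2 \<inter> e3 = {a}" "b \<noteq> c"
    and np: "\<And>a b c. trip a b c \<Longrightarrow> near a b"
  shows "cov E 6"
proof -
  have E: "e1 \<in> E" "e2 \<in> E" "e3 \<in> E"
    using t by (auto simp: trip_def)
  have 1: "trip e2 e1 e3" "trip e3 e1 e2" "trip e1 e3 e2" "trip e2 e3 e1"
    using t trip_perm by blast+
  have i': "e2 \<inter> e1 = {c}" "e3 \<inter> e1 = {b}" "e3 \<inter> e2 = {a}"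
    using i by auto
  have "c \<in> e1" "b \<in> e1" "a \<in> e3" "a \<in> e2"
    using i by auto
  then have ne: "a \<noteq> c" "a \<noteq> b"
    using i by (metis IntI singletonD)+
  obtain x where x: "e1 = {x, b, c}" "x \<notin> e2" "x \<notin> e3" "b \<notin> e2" "c \<notin> e3" "x \<noteq> b" "x \<noteq> c"
    using center_form[OF E(1) i(1,2,4)] .
  obtain y where y: "e2 = {y, a, c}" "y \<notin> e1" "y \<notin> e3" "a \<notin> e1" "y \<noteq> a" "y \<noteq> c"
    using center_form[OF E(2) i'(1) i(3) ne(1)] by metis
  obtain z where z: "e3 = {z, a, b}" "z \<notin> e1" "z \<notin> e2" "z \<noteq> a" "z \<noteq> b"
    using center_form[OF E(3) i'(2,3) ne(2)] by metis
  have d: "distinct [a, b, c, x, y, z]"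
    using x y z ne i(4) by auto
  have np': "near f s \<and> near f r" if "f \<in> priv q s r" "trip q s r" for f q s r
  proof -
    have "trip f s r"
      using that by (auto simp: priv_def trip_def)
    then show ?thesis
      using np trip_perm by blast
  qed
  obtain s1 where s1: "s1 = {b, c} \<or> s1 = {x, c} \<or> s1 = {x, b}" "priv e1 e2 e3 \<subseteq> star s1"
    using priv_star[OF t i(1,2) x(1) i(4) np'[OF _ t]] .
  obtain s2 where s2: "s2 = {a, c} \<or> s2 = {y, c} \<or> s2 = {y, a}" "priv e2 e1 e3 \<subseteq> star s2"
    using priv_star[OF 1(1) i'(1) i(3) y(1) ne(1) np'[OF _ 1(1)]] .
  obtain s3 where s3: "s3 = {a, b} \<or> s3 = {z, b} \<or> s3 = {z, a}" "priv e3 e1 e2 \<subseteq> star s3"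
    using priv_star[OF 1(2) i'(2,3) z(1) ne(2) np'[OF _ 1(2)]] .
  define Q where "Q = {{a, b, c}, {c, x, y}, {c, x, a}, {c, b, y}, {b, x, z}, {b, x, a}, {b, c, z}, {a, y, z}, {a, y, b}, {a, c, z}}"
  obtain t1 t2 t3 where ts: "card t1 = 2" "card t2 = 2" "card t3 = 2"
    "\<forall>f\<in>Q. s1 \<subseteq> f \<or> s2 \<subseteq> f \<or> s3 \<subseteq> f \<or> t1 \<subseteq> f \<or> t2 \<subseteq> f \<or> t3 \<subseteq> f"
    using triangle_cover[OF d s1(1) s2(1) s3(1)] unfolding Q_def .
  have D: "e1 - e2 = {x, b}" "e2 - e1 = {y, a}" "e1 - e3 = {x, c}" "e3 - e1 = {z, a}" "e2 - e3 = {y, c}" "e3 - e2 = {z, b}"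
    using x(1) y(1) z(1) d by auto
  \<comment> \<open>The triple of the three intersection points is a corner of all three grids,
    which is why \<open>Q\<close> has only ten members.\<close>
  have eq: "{c, b, a} = {a, b, c}" "{b, c, a} = {a, b, c}" "{a, c, b} = {a, b, c}"
    by auto
  have "common e1 e2 \<subseteq> Q" "common e1 e3 \<subseteq> Q" "common e2 e3 \<subseteq> Q"
    using common_subset[OF t i(1) D(1,2)] common_subset[OF 1(3) i(2) D(3,4)] common_subset[OF 1(4) i(3) D(5,6)]
    unfolding eq Q_def by (elim order_trans; simp)+
  then have common: "common e1 e2 \<union> common e1 e3 \<union> common e2 e3 \<subseteq> Q"
    by simp
  define S where "S = star s1 \<union> star s2 \<union> star s3 \<union> star t1 \<union> star t2 \<union> star t3"
  have "Q \<subseteq> S"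
    using ts(4) by (auto simp: S_def star_def)
  have c: "card s1 = 2" "card s2 = 2" "card s3 = 2"
    using s1(1) s2(1) s3(1) d by auto
  have "cov S (1 + 1 + 1 + 1 + 1 + 1)"
    unfolding S_def using c ts by (intro cov_Un cov_pair)
  moreover have "e1 \<in> star s1" "e2 \<in> star s2" "e3 \<in> star s3"
    using s1(1) s2(1) s3(1) x(1) y(1) z(1) by (auto simp: star_def)
  then have "{e1, e2, e3} \<union> priv e1 e2 e3 \<union> priv e2 e1 e3 \<union> priv e3 e1 e2 \<subseteq> S"
    using s1(2) s2(2) s3(2) by (simp add: S_def le_supI1 le_supI2)
  then have "E \<subseteq> S"
    using order_trans[OF common \<open>Q \<subseteq> S\<close>] by (intro order_trans[OF E_split[OF t]]) simp
  ultimately show ?thesis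
    by (rule cov_mono) simp
qed

text \<open>If two of the three intersection points coincide, all three do and the edges form a
  sunflower; otherwise they form a triangle.\<close>

lemma cov_three_near_triples:
  assumes t: "trip e1 e2 e3" and np: "\<And>a b c. trip a b c \<Longrightarrow> near a b"
  shows "cov E 6"
proof -
  have n: "near e1 e2" "near e1 e3" "near e2 e3"
    using np[OF t] np[OF trip_perm(2)[OF t]] np[OF trip_perm(2)[OF trip_perm(1)[OF t]]] by simp_all
  obtain c where c: "e1 \<inter> e2 = {c}"
    using near_singleton[OF n(1)] .
  obtain b where b: "e1 \<inter> e3 = {b}"
    using near_singleton[OF n(2)] .
  obtain a where a: "e2 \<inter> e3 = {a}"
    using near_singleton[OF n(3)] .
  show ?thesis
  proof (cases "b = c")
    case True
    then have "c \<in> e2 \<inter> e3"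
      using b c by auto
    then have "e2 \<inter> e3 = {c}"
      using a by simp
    moreover have "e1 \<inter> e3 = {c}"
      using b True by simp
    ultimately show ?thesis
      by (intro cov_sunflower[OF t c]) (assumption | erule np)+
  next
    case False
    then show ?thesis
      by (rule cov_triangle[OF t c b a]) (erule np)
  qed
qed

section \<open>Triples with two near pairs\<close>

lemma cov_two_stars:
  assumes "card s = 2" "card t = 2"
  shows "cov (star s \<union> star t) 2"
  using cov_Un[OF cov_pair[OF assms(1)] cov_pair[OF assms(2)]] unfolding one_add_one .

text \<open>
  For triples, a star leaves one of the two pairs spent on \<open>b\<close> free, and some simplices cover the
  common neighbours on their own; what remains are simplices whose apex \<open>y\<close> lies in \<open>c\<close>.
\<close>

lemma side_cases:
  assumes t: "trip a b c" and m: "a \<inter> b = {m}" and n: "near a c" and bc: "b \<inter> c = {}"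
    and np: "\<And>f. f \<in> priv b a c \<Longrightarrow> near f a \<or> near f c"
  obtains (free) "\<And>s. card s = 2 \<Longrightarrow> cov (insert b (priv b a c) \<union> star s) 2"
  | (self) "cov (insert b (priv b a c \<union> common a b)) 2"
  | (cross) y U where "y \<in> c - a" "U \<subseteq> b" "2 \<le> card U" "priv b a c = (\<lambda>v. insert y (b - {v})) ` U"
proof -
  have E: "a \<in> E" "b \<in> E" "c \<in> E" and i: "ind a b"
    using t by (auto simp: trip_def)
  have nab: "near a b" "near b a"
    using m by (simp_all add: near_iff Int_commute)
  have t': "trip b a c"
    using t by (rule trip_perm)
  have mab: "m \<in> a" "m \<in> b"
    using m by auto
  have "card (b \<inter> a) = 1"
    using nab(2) by (simp add: near_iff)
  from t' show thesis
  proof (cases rule: priv_cases)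
    case (star s)
    then have "card s = 2" "b \<in> star s"
      using k by (auto simp: star_def)
    then show ?thesis
      using star(3) by (intro free) (auto intro: cov_mono[OF cov_two_stars[of s]])
  next
    case (simplex y U)
    have f: "v \<in> b" "insert y (b - {v}) \<in> priv b a c" if "v \<in> U" for v
      using that simplex by auto
    show ?thesis
    proof (cases "y \<in> a")
      case True
      \<comment> \<open>An apex in \<open>a\<close> must be balanced by removing the only vertex of
        \<open>b\<close> in \<open>a\<close>, so two different exchanges are impossible.\<close>
      have "v = m" if v: "v \<in> U" for v
      proof -
        have "ind (insert y (b - {v})) a"
          using f(2)[OF v] by (simp add: priv_def)
        moreover have "card (insert y (b - {v}) \<inter> a) + of_bool (v \<in> a) = card (b \<inter> a) + of_bool (y \<in> a)"
          using f(1)[OF v] simplex(1) E fin by (intro card_swap_Int) auto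
        ultimately have "v \<in> a"
          using True \<open>card (b \<inter> a) = 1\<close> k unfolding ind_def by (cases "v \<in> a") simp_all
        then have "v \<in> a \<inter> b"
          using f(1)[OF v] by simp
        then show ?thesis
          using m by simp
      qed
      then have "U \<subseteq> {m}"
        by auto
      then have "card U \<le> 1"
        using card_mono[of "{m}" U] by simp
      then show ?thesis
        using simplex(3) by simp
    next
      case ya: False
      show ?thesis
      proof (cases "y \<in> c")
        case True
        then show ?thesis
          using ya simplex by (intro cross[of y U]) auto
      next
        case False
        \<comment> \<open>The new edge misses \<open>c\<close>, so it has to be near
          \<open>a\<close> and must keep \<open>m\<close>. All exchanges and all common neighbours
          then contain \<open>{m, q}\<close> or \<open>{m, q'}\<close>.\<close>
        have "v \<notin> a" if v: "v \<in> U" for v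
        proof -
          have "insert y (b - {v}) \<inter> c = {}"
            using bc False by auto
          then have "\<not> near (insert y (b - {v})) c"
            by (simp add: near_iff)
          then have "near (insert y (b - {v})) a"
            using np f(2)[OF v] by blast
          then show ?thesis
            using simplex_near[OF E(2) nab(2) simplex(1) f(1)[OF v]] ya by simp
        qed
        then have U: "U \<subseteq> b - a"
          using simplex(2) by auto
        obtain q q' where q: "b - a = {q, q'}" "q \<noteq> q'"
          using near_Diff[OF E(2,1) nab(2)] .
        have b: "b = {m, q, q'}" "m \<noteq> q" "m \<noteq> q'"
        proof -
          have "b = (b - a) \<union> (a \<inter> b)"
            by auto
          then show "b = {m, q, q'}"
            unfolding q m by auto
          have "q \<in> b - a" "q' \<in> b - a"
            unfolding q by simp_all
          then show "m \<noteq> q" "m \<noteq> q'"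
            using mab by auto
        qed
        obtain p p' where p: "a - b = {p, p'}" "p \<noteq> p'"
          using near_Diff[OF E(1,2) nab(1)] .
        have "common a b \<subseteq> star {m, q} \<union> star {m, q'}"
          using common_subset[OF t m p(1) q(1)] by (rule order_trans) (simp add: star_def)
        moreover have "priv b a c \<subseteq> star {m, q} \<union> star {m, q'}"
          using U b q(2) unfolding simplex(4) q(1) by (auto simp: star_def)
        moreover have "b \<in> star {m, q}"
          using b by (simp add: star_def)
        ultimately have "insert b (priv b a c \<union> common a b) \<subseteq> star {m, q} \<union> star {m, q'}"
          by simp
        moreover have "cov (star {m, q} \<union> star {m, q'}) 2"
          using b by (intro cov_two_stars) simp_all
        ultimately show ?thesis
          by (intro self) (rule cov_subset)
      qed
    qed
  qed
qed

text \<open>Of the outcomes of \<open>side_cases\<close>, a free pair could be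
  \<open>{x, m}\<close>, which covers the half of the grid containing \<open>x\<close>, and the
  self-covering case is immediate. Only a crossing simplex can therefore block the cover, and this
  half of the grid must be full.\<close>

lemma cross_if_not_cov:
  assumes t: "trip a b c" and m: "a \<inter> b = {m}" and n: "near a c" and bc: "b \<inter> c = {}"
    and np: "\<And>f. f \<in> priv b a c \<Longrightarrow> near f a \<or> near f c"
    and x: "x \<in> a - b" and not_cov: "\<not> cov (insert b (priv b a c \<union> {f \<in> common a b. x \<in> f})) 2"
  obtains y U where "y \<in> c - a" "U \<subseteq> b" "2 \<le> card U" "priv b a c = (\<lambda>v. insert y (b - {v})) ` U"
    "\<forall>q\<in>b - a. {x, m, q} \<in> E"
proof -
  have E: "a \<in> E" "b \<in> E"
    using t by (auto simp: trip_def)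
  have t': "trip b a c"
    using t by (rule trip_perm)
  have nab: "near a b" "near b a"
    using m by (simp_all add: near_iff Int_commute)
  obtain q q' where q: "b - a = {q, q'}" "q \<noteq> q'"
    using near_Diff[OF E(2,1) nab(2)] .
  obtain p p' where p: "a - b = {p, p'}" "p \<noteq> p'"
    using near_Diff[OF E nab(1)] .
  have mab: "m \<in> a" "m \<in> b"
    using m by auto
  have qb: "q \<in> b" "q' \<in> b" "q \<notin> a" "q' \<notin> a" "p \<in> a" "p' \<in> a" "p \<notin> b" "p' \<notin> b"
    using p q by auto
  have xc: "f = {x, m, q} \<or> f = {x, m, q'}" if f: "f \<in> common a b" "x \<in> f" for f
  proof -
    have "f \<in> {{m, p, q}, {m, p, q'}, {m, p', q}, {m, p', q'}}"
      using common_subset[OF t m p(1) q(1)] f(1) by auto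
    moreover have "x \<in> {p, p'}" "x \<noteq> m" "x \<noteq> q" "x \<noteq> q'"
      using x mab qb unfolding p[symmetric] by auto
    ultimately show ?thesis
      using f(2) by auto
  qed
  have all: "{x, m, r} \<in> E" if r: "r \<in> b - a" for r
  proof (rule ccontr)
    assume "{x, m, r} \<notin> E"
    \<comment> \<open>The one remaining edge of this half contains \<open>b - {r}\<close>, which
      comes free with the sets spent on \<open>b\<close>.\<close>
    then have "{f \<in> common a b. x \<in> f} \<subseteq> star (b - {r})"
    proof -
      have "b = (a \<inter> b) \<union> (b - a)"
        by auto
      then have "b = {m, q, q'}"
        unfolding m q by auto
      moreover have "f \<noteq> {x, m, r}" if "f \<in> common a b" for f
        using that \<open>{x, m, r} \<notin> E\<close> by (auto simp: common_def)
      moreover have "r = q \<or> r = q'"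
        using r unfolding q by simp
      ultimately show ?thesis
        using xc by (auto simp: star_def)
    qed
    then have "insert b (priv b a c \<union> {f \<in> common a b. x \<in> f}) \<subseteq> insert b (priv b a c \<union> star (b - {r}))"
      by blast
    moreover have "cov (insert b (priv b a c \<union> star (b - {r}))) 2"
      using cov_priv_star[OF t', of r] r by (simp add: h_eq)
    ultimately have "cov (insert b (priv b a c \<union> {f \<in> common a b. x \<in> f})) 2"
      by (rule cov_subset)
    with not_cov show False ..
  qed
  show thesis
  proof (rule side_cases[OF t m n bc np])
    assume free: "\<And>s. card s = 2 \<Longrightarrow> cov (insert b (priv b a c) \<union> star s) 2"
    have "x \<noteq> m"
      using x mab by auto
    then have "cov (insert b (priv b a c) \<union> star {x, m}) 2"
      using free[of "{x, m}"] by simp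
    moreover
    have "{f \<in> common a b. x \<in> f} \<subseteq> star {x, m}"
      using xc by (auto simp: star_def)
    then have "insert b (priv b a c \<union> {f \<in> common a b. x \<in> f}) \<subseteq> insert b (priv b a c) \<union> star {x, m}"
      by blast
    ultimately have "cov (insert b (priv b a c \<union> {f \<in> common a b. x \<in> f})) 2"
      by (rule cov_subset[rotated])
    with not_cov show ?thesis ..
  next
    assume "cov (insert b (priv b a c \<union> common a b)) 2"
    then have "cov (insert b (priv b a c \<union> {f \<in> common a b. x \<in> f})) 2"
      by (rule cov_mono) auto
    with not_cov show ?thesis ..
  next
    fix y U
    assume "y \<in> c - a" "U \<subseteq> b" "2 \<le> card U" "priv b a c = (\<lambda>v. insert y (b - {v})) ` U"
    then show ?thesis
      by (rule that) (simp add: all)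
  qed
qed

text \<open>Two pairs go to \<open>e2\<close> with its half of the grid and two to
  \<open>e3\<close>. The pairs \<open>{b, c}\<close> and \<open>{x, b}\<close> cover
  \<open>e1\<close> and its private neighbours, the other half of that grid, and all common
  neighbours of \<open>e1\<close> and \<open>e3\<close>.\<close>

lemma cov_from_one_side:
  assumes t: "trip e1 e2 e3" and i: "e1 \<inter> e2 = {c}" "e1 \<inter> e3 = {b}" "b \<noteq> c" "e2 \<inter> e3 = {}"
    and e1: "e1 = {x, b, c}" "x \<noteq> b" "x \<noteq> c"
    and pr: "priv e1 e2 e3 \<subseteq> star {b, c} \<union> star {x, b}"
    and cv: "cov (insert e2 (priv e2 e1 e3 \<union> {f \<in> common e1 e2. x \<in> f})) 2"
  shows "cov E 6"
proof -
  have E: "e1 \<in> E" "e2 \<in> E" "e3 \<in> E"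
    using t by (auto simp: trip_def)
  have t2: "trip e1 e3 e2" and t3: "trip e3 e1 e2" and t4: "trip e2 e3 e1"
    using trip_perm(2)[OF t] trip_perm(1)[OF trip_perm(2)[OF t]] trip_perm(2)[OF trip_perm(1)[OF t]]
    by simp_all
  have D: "e1 - e2 = {x, b}" "e1 - e3 = {x, c}"
  proof -
    have "w \<in> e2 \<longleftrightarrow> w = c" "w \<in> e3 \<longleftrightarrow> w = b" if "w \<in> {x, b, c}" for w
      using i(1,2) that unfolding e1 by (auto simp: set_eq_iff)
    then show "e1 - e2 = {x, b}" "e1 - e3 = {x, c}"
      using e1(2,3) i(3) unfolding e1(1) by auto
  qed
  have nr: "near e1 e2" "near e1 e3" "\<not> near e2 e3"
    using i by (simp_all add: near_iff)
  obtain q q' where q: "e2 - e1 = {q, q'}"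
    using near_Diff[OF E(2,1)] nr(1) near_sym by metis
  obtain r r' where r: "e3 - e1 = {r, r'}"
    using near_Diff[OF E(3,1)] nr(2) near_sym by metis
  define S where "S = insert e2 (priv e2 e1 e3 \<union> {f \<in> common e1 e2. x \<in> f}) \<union> insert e3 (priv e3 e1 e2)
     \<union> star {b, c} \<union> star {x, b}"
  have "common e1 e2 \<subseteq> {f \<in> common e1 e2. x \<in> f} \<union> star {b, c}"
    using common_subset[OF t i(1) D(1) q] by (auto simp: star_def)
  then have "common e1 e2 \<subseteq> S"
    unfolding S_def by blast
  moreover have "common e1 e3 \<subseteq> star {b, c} \<union> star {x, b}"
    using common_subset[OF t2 i(2) D(2) r] by (rule order_trans) (simp add: star_def)
  then have "common e1 e3 \<subseteq> S"
    unfolding S_def by blast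
  moreover have "e1 \<in> S" "e2 \<in> S" "e3 \<in> S"
    by (simp_all add: S_def star_def e1(1))
  moreover have "priv e1 e2 e3 \<subseteq> S" "priv e2 e1 e3 \<subseteq> S" "priv e3 e1 e2 \<subseteq> S"
    using pr unfolding S_def by blast+
  moreover have "common e2 e3 = {}"
    using common_far[OF t4 nr(3)] .
  ultimately have "E \<subseteq> S"
    by (intro order_trans[OF E_split[OF t]]) simp
  moreover have "cov S (2 + 2 + 1 + 1)"
    unfolding S_def using cv cov_priv[OF t3] i(3) e1(2) h_eq by (intro cov_Un cov_pair) auto
  ultimately show ?thesis
    by (intro cov_mono[of S "2 + 2 + 1 + 1" E]) simp_all
qed

lemma four_triples_meet:
  assumes "a \<in> E" "b \<in> E" "c \<in> E" "d \<in> E"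
    "card (a \<inter> b) \<le> 1" "card (a \<inter> c) \<le> 1" "card (a \<inter> d) \<le> 1" "card (b \<inter> c) \<le> 1" "card (b \<inter> d) \<le> 1" "card (c \<inter> d) \<le> 1"
  shows False
  using assms no4[of a b c d] k unfolding ind_def by simp

text \<open>Sets of four triples pairwise meeting in at most one vertex exclude \<open>y\<close>
  from \<open>U\<close> and \<open>z\<close> from \<open>W\<close>. Hence the private neighbours of
  \<open>e2\<close> and of \<open>e3\<close> all contain \<open>{y, z}\<close>, and a single pair
  serves both sides.\<close>

lemma cov_crossing:
  assumes t: "trip e1 e2 e3" and e: "e1 = {x, b, c}" "e2 = {c, y, y'}" "e3 = {b, z, z'}"
    and d: "distinct [x, b, c, y, y', z, z']"
    and H: "{x, c, y} \<in> E" "{x, c, y'} \<in> E" "{x, b, z} \<in> E" "{x, b, z'} \<in> E"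
    and U: "U \<subseteq> e2" "2 \<le> card U" "priv e2 e1 e3 = (\<lambda>v. insert z (e2 - {v})) ` U"
    and W: "W \<subseteq> e3" "2 \<le> card W" "priv e3 e1 e2 = (\<lambda>v. insert y (e3 - {v})) ` W"
    and pr: "priv e1 e2 e3 \<subseteq> star {b, c}"
  shows "cov E 6"
proof -
  have Um: "insert z (e2 - {v}) \<in> E" if "v \<in> U" for v
    using that U(3) by (auto simp: priv_def)
  have Wm: "insert y (e3 - {v}) \<in> E" if "v \<in> W" for v
    using that W(3) by (auto simp: priv_def)
  have D: "e2 - {y} = {c, y'}" "e2 - {c} = {y, y'}" "e3 - {z} = {b, z'}" "e3 - {b} = {z, z'}"
    using d unfolding e by auto
  have Uc: "y \<in> U \<or> c \<in> U"
  proof (rule ccontr)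
    assume "\<not> (y \<in> U \<or> c \<in> U)"
    then have "U \<subseteq> {y'}"
      using U(1) e(2) by auto
    then show False
      using U(2) card_mono[of "{y'}" U] by simp
  qed
  have Wc: "z \<in> W \<or> b \<in> W"
  proof (rule ccontr)
    assume "\<not> (z \<in> W \<or> b \<in> W)"
    then have "W \<subseteq> {z'}"
      using W(1) e(3) by auto
    then show False
      using W(2) card_mono[of "{z'}" W] by simp
  qed
  have zW: "z \<notin> W"
  proof
    assume "z \<in> W"
    then have 1: "{y, b, z'} \<in> E"
      using Wm[of z] D by simp
    from Uc show False
    proof
      assume "y \<in> U"
      then have "{z, c, y'} \<in> E"
        using Um[of y] D by simp
      from four_triples_meet[OF this 1 H(1,3)] d show False
        by (auto simp: Int_insert_left Int_insert_right)
    next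
      assume "c \<in> U"
      then have "{z, y, y'} \<in> E"
        using Um[of c] D by simp
      from four_triples_meet[OF this 1 H(2,3)] d show False
        by (auto simp: Int_insert_left Int_insert_right)
    qed
  qed
  have yU: "y \<notin> U"
  proof
    assume "y \<in> U"
    then have 1: "{z, c, y'} \<in> E"
      using Um[of y] D by simp
    have "{y, z, z'} \<in> E"
      using Wc zW Wm[of b] D by simp
    from four_triples_meet[OF this 1 H(4,1)] d show False
      by (auto simp: Int_insert_left Int_insert_right)
  qed
  \<comment> \<open>The pairs inside \<open>e1\<close> cover both grids; \<open>{c, y}\<close> and
    \<open>{b, z}\<close> are there for \<open>e2\<close> and \<open>e3\<close> themselves.\<close>
  define S where "S = star {b, c} \<union> star {x, b} \<union> star {x, c} \<union> star {c, y} \<union> star {b, z} \<union> star {y, z}"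
  have t2: "trip e1 e3 e2" and t4: "trip e2 e3 e1"
    using trip_perm(2)[OF t] trip_perm(2)[OF trip_perm(1)[OF t]] by simp_all
  have "y \<in> e2" "z \<in> e3"
    by (simp_all add: e)
  then have "priv e2 e1 e3 \<subseteq> star {y, z}" "priv e3 e1 e2 \<subseteq> star {y, z}"
    using yU zW unfolding U(3) W(3) by (auto simp: star_def)
  then have p: "priv e1 e2 e3 \<subseteq> S" "priv e2 e1 e3 \<subseteq> S" "priv e3 e1 e2 \<subseteq> S"
    using pr unfolding S_def by blast+
  have i: "e1 \<inter> e2 = {c}" "e1 \<inter> e3 = {b}" "e2 \<inter> e3 = {}"
    and Df: "e1 - e2 = {x, b}" "e2 - e1 = {y, y'}" "e1 - e3 = {x, c}" "e3 - e1 = {z, z'}"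
    using d unfolding e by auto
  have "common e1 e2 \<subseteq> S" "common e1 e3 \<subseteq> S"
    by (rule order_trans[OF common_subset[OF t i(1) Df(1,2)]], simp add: S_def star_def)
      (rule order_trans[OF common_subset[OF t2 i(2) Df(3,4)]], simp add: S_def star_def)
  moreover have "common e2 e3 = {}"
    using i by (intro common_far[OF t4]) (simp add: near_iff)
  moreover have "e1 \<in> S" "e2 \<in> S" "e3 \<in> S"
    by (simp_all add: S_def star_def e)
  ultimately have "E \<subseteq> S"
    using p by (intro order_trans[OF E_split[OF t]]) simp
  moreover have "cov S (1 + 1 + 1 + 1 + 1 + 1)"
    unfolding S_def using d by (intro cov_Un cov_pair) auto
  ultimately show ?thesis
    by (intro cov_mono[of S "1 + 1 + 1 + 1 + 1 + 1" E]) simp_all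
qed

text \<open>Without a cover, the side of \<open>e2\<close> is a crossing simplex with a full
  half-grid. A private neighbour \<open>{w, x, b}\<close> of \<open>e1\<close>, the grid edge
  \<open>{x, c, w'}\<close>, a simplex edge \<open>g\<close> and \<open>e3\<close> are then four
  pairwise independent edges.\<close>

lemma cov_if_priv_star:
  assumes t: "trip e1 e2 e3" and i: "e1 \<inter> e2 = {c}" "e1 \<inter> e3 = {b}" "b \<noteq> c" "e2 \<inter> e3 = {}"
    and e1: "e1 = {x, b, c}" "x \<noteq> b" "x \<noteq> c"
    and np: "\<And>f. f \<in> priv e2 e1 e3 \<Longrightarrow> near f e1 \<or> near f e3"
      "\<And>f. f \<in> priv e1 e2 e3 \<Longrightarrow> near f e2"
    and pr: "priv e1 e2 e3 \<subseteq> star {x, b}" "\<not> priv e1 e2 e3 \<subseteq> star {b, c}"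
  shows "cov E 6"
proof (rule ccontr)
  assume not6: "\<not> cov E 6"
  have E: "e1 \<in> E" "e2 \<in> E" "e3 \<in> E"
    using t by (auto simp: trip_def)
  have nr: "near e1 e3" "near e1 e2" "near e2 e1"
    using i by (simp_all add: near_iff Int_commute)
  have mem: "w \<in> e2 \<longleftrightarrow> w = c" "w \<in> e3 \<longleftrightarrow> w = b" if "w \<in> {x, b, c}" for w
    using i(1,2) that unfolding e1 by (auto simp: set_eq_iff)
  have nc: "\<not> cov (insert e2 (priv e2 e1 e3 \<union> {f \<in> common e1 e2. x \<in> f})) 2"
    using not6 cov_from_one_side[OF t i e1 le_supI2[OF pr(1)]] by (rule contrapos_nn)
  have x: "x \<in> e1 - e2"
    using mem e1 by auto
  obtain y U where y: "y \<in> e3 - e1" "U \<subseteq> e2" "2 \<le> card U"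
    "priv e2 e1 e3 = (\<lambda>v. insert y (e2 - {v})) ` U" "\<forall>q\<in>e2 - e1. {x, c, q} \<in> E"
    using cross_if_not_cov[OF t i(1) nr(1) i(4) np(1) x nc] .
  obtain f where f: "f \<in> priv e1 e2 e3" "\<not> {b, c} \<subseteq> f"
    using pr(2) by (auto simp: star_def)
  have fE: "f \<in> E" "adj f e1"
    using f by (auto simp: priv_def)
  obtain u w where uw: "u \<in> e1" "w \<notin> e1" "f = insert w (e1 - {u})"
    using adj_swap[OF E(1) fE] .
  have "{x, b} \<subseteq> f"
    using pr(1) f(1) by (auto simp: star_def)
  then have "u = c"
    using uw e1 f(2) by auto
  then have fe: "f = {w, x, b}" and "w \<in> e2"
    using uw e1 i(3) simplex_near[OF E(1) nr(2) uw(2,1)] np(2)[OF f(1)] mem by auto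
  then have w: "w \<in> e2 - e1"
    using uw by simp
  obtain q q' where "e2 - e1 = {q, q'}" "q \<noteq> q'"
    using near_Diff[OF E(2,1) nr(3)] .
  then obtain w' where w': "e2 - e1 = {w, w'}" "w \<noteq> w'"
    using w by auto
  have "e2 = (e2 - e1) \<union> (e1 \<inter> e2)"
    by auto
  then have e2: "e2 = {c, w, w'}"
    unfolding w' i(1) by auto
  have c1: "w' \<in> e2 - e1"
    using w' by simp
  \<comment> \<open>Exchanging a vertex other than \<open>w\<close> keeps \<open>g\<close> from
    containing both \<open>c\<close> and \<open>w'\<close>, so \<open>g\<close> meets
    \<open>{x, c, w'}\<close> only once.\<close>
  have "\<not> U \<subseteq> {w}"
    using y(3) card_mono[of "{w}" U] by auto
  then obtain v where v: "v \<in> U" "v \<noteq> w"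
    by auto
  define g where "g = insert y (e2 - {v})"
  have "g \<in> priv e2 e1 e3"
    unfolding g_def y(4) using v(1) by simp
  then have g: "g \<in> E" "ind g e3"
    by (simp_all add: priv_def)
  have mem2: "x \<notin> e2" "b \<notin> e2" "x \<notin> e3" "c \<notin> e3" "w \<notin> e3" "w' \<notin> e3"
    using mem e1 i(3) w w' i(4) by auto
  have yd: "y \<noteq> x" "y \<noteq> b" "y \<noteq> c" "y \<noteq> w" "y \<noteq> w'"
    using y(1) mem2 e1 by auto
  have wd: "w \<noteq> x" "w \<noteq> b" "w \<noteq> c" "w' \<noteq> x" "w' \<noteq> b" "w' \<noteq> c"
    using w c1 e1 by auto
  have "v = c \<or> v = w'"
    using v y(2) e2 by auto
  moreover have "e2 - {c} = {w, w'}" "e2 - {w'} = {c, w}"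
    using wd w'(2) by (auto simp: e2)
  ultimately have "g = {y, w, w'} \<or> g = {y, c, w}"
    unfolding g_def by metis
  then have c2: "card (f \<inter> g) \<le> 1" "card ({x, c, w'} \<inter> g) \<le> 1"
    using wd yd w'(2) e1(2,3) i(3) unfolding fe by (elim disjE; simp add: Int_insert_left)+
  have c3: "card (f \<inter> {x, c, w'}) \<le> 1"
    using wd w'(2) e1 i(3) unfolding fe by (simp add: Int_insert_left)
  have "f \<inter> e3 \<subseteq> {b}" "{x, c, w'} \<inter> e3 = {}"
    using mem2 unfolding fe by auto
  then have c4: "card (f \<inter> e3) \<le> 1" "card ({x, c, w'} \<inter> e3) \<le> 1"
    using card_mono[of "{b}" "f \<inter> e3"] by simp_all
  have c5: "card (g \<inter> e3) \<le> 1"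
    using g(2) k unfolding ind_def by simp
  have c6: "{x, c, w'} \<in> E"
    using y(5) c1 by simp
  show False
    by (rule four_triples_meet[OF fE(1) c6 g(1) E(3) c3 c2(1) c4(1) c2(2) c4(2) c5])
qed

text \<open>The private neighbours of \<open>e1\<close> form a star. If its pair contains
  \<open>x\<close>, \<open>cov_if_priv_star\<close> applies, up to swapping \<open>e2\<close> and
  \<open>e3\<close>. If it is \<open>{b, c}\<close>, failure of the cover makes both sides crossing
  simplices, which \<open>cov_crossing\<close> handles.\<close>

lemma cov_two_near_triples:
  assumes t: "trip e1 e2 e3" and n: "near e1 e2" "near e1 e3" "\<not> near e2 e3"
    and two: "\<And>a b c. trip a b c \<Longrightarrow> near a b \<or> near a c"
  shows "cov E 6"
proof -
  have E: "e1 \<in> E" "e2 \<in> E" "e3 \<in> E" "ind e2 e3"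
    using t by (auto simp: trip_def)
  have t2: "trip e2 e1 e3" and t3: "trip e3 e1 e2" and t4: "trip e1 e3 e2"
    using trip_perm(1)[OF t] trip_perm(1)[OF trip_perm(2)[OF t]] trip_perm(2)[OF t] by simp_all
  \<comment> \<open>For triples, independent edges that are not near are disjoint.\<close>
  have "card (e2 \<inter> e3) = 0"
    using n(3) E(4) k unfolding near_def ind_def by simp
  then have i3: "e2 \<inter> e3 = {}" "e3 \<inter> e2 = {}"
    using E fin by auto
  obtain c where c: "e1 \<inter> e2 = {c}"
    using near_singleton[OF n(1)] .
  obtain b where b: "e1 \<inter> e3 = {b}"
    using near_singleton[OF n(2)] .
  have bc: "b \<noteq> c"
  proof
    assume "b = c"
    then have "c \<in> e2 \<inter> e3"
      using b c by auto
    then show False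
      using i3 by simp
  qed
  obtain x where x: "e1 = {x, b, c}" "x \<notin> e2" "x \<notin> e3" "b \<notin> e2" "c \<notin> e3" "x \<noteq> b" "x \<noteq> c"
    using center_form[OF E(1) c b bc] .
  have x': "e1 = {x, c, b}"
    using x(1) by auto
  have np1: "near f e2 \<and> near f e3" if "f \<in> priv e1 e2 e3" for f
  proof -
    have "trip e2 f e3" "trip e3 f e2"
      using that E t by (auto simp: priv_def trip_def ind_sym)
    then show ?thesis
      using two n(3) near_sym by metis
  qed
  have np2: "near f e1 \<or> near f e3" if "f \<in> priv e2 e1 e3" for f
    using that two[of f e1 e3] t by (auto simp: priv_def trip_def)
  have np3: "near f e1 \<or> near f e2" if "f \<in> priv e3 e1 e2" for f
    using that two[of f e1 e2] t by (auto simp: priv_def trip_def)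
  show ?thesis
  proof (cases "priv e1 e2 e3 \<subseteq> star {b, c}")
    case False
    obtain s where s: "s = {b, c} \<or> s = {x, c} \<or> s = {x, b}" "priv e1 e2 e3 \<subseteq> star s"
      using priv_star[OF t c b x(1) bc np1] .
    then consider "priv e1 e2 e3 \<subseteq> star {x, b}" | "priv e1 e2 e3 \<subseteq> star {x, c}"
      using False by auto
    then show ?thesis
    proof cases
      case 1
      show ?thesis
        by (rule cov_if_priv_star[OF t c b bc i3(1) x(1,6,7) _ _ 1 False]) (use np1 np2 in blast)+
    next
      case 2
      have 3: "priv e1 e3 e2 \<subseteq> star {x, c}" "\<not> priv e1 e3 e2 \<subseteq> star {c, b}"
        using 2 False priv_commute[of e1 e2 e3] by (simp_all add: insert_commute)
      show ?thesis
        by (rule cov_if_priv_star[OF t4 b c bc[symmetric] i3(2) x' x(7,6) _ _ 3])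
          (use np1 np3 priv_commute[of e1 e2 e3] in auto)
    qed
  next
    case pr: True
    show ?thesis
    proof (rule ccontr)
      assume not6: "\<not> cov E 6"
      have nc: "\<not> cov (insert e2 (priv e2 e1 e3 \<union> {f \<in> common e1 e2. x \<in> f})) 2"
        using not6 cov_from_one_side[OF t c b bc i3(1) x(1,6,7) le_supI1[OF pr]] by (rule contrapos_nn)
      have xD: "x \<in> e1 - e2" "x \<in> e1 - e3"
        using x by simp_all
      obtain z U where z: "z \<in> e3 - e1" "U \<subseteq> e2" "2 \<le> card U"
        "priv e2 e1 e3 = (\<lambda>v. insert z (e2 - {v})) ` U" "\<forall>q\<in>e2 - e1. {x, c, q} \<in> E"
        using cross_if_not_cov[OF t c n(2) i3(1) np2 xD(1) nc] .
      have pr': "priv e1 e3 e2 \<subseteq> star {c, b}"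
        using pr priv_commute[of e1 e2 e3] by (simp add: insert_commute)
      have nc': "\<not> cov (insert e3 (priv e3 e1 e2 \<union> {f \<in> common e1 e3. x \<in> f})) 2"
        using not6 cov_from_one_side[OF t4 b c bc[symmetric] i3(2) x' x(7,6) le_supI1[OF pr']] by (rule contrapos_nn)
      obtain y W where y: "y \<in> e2 - e1" "W \<subseteq> e3" "2 \<le> card W"
        "priv e3 e1 e2 = (\<lambda>v. insert y (e3 - {v})) ` W" "\<forall>q\<in>e3 - e1. {x, b, q} \<in> E"
        using cross_if_not_cov[OF t4 b n(1) i3(2) np3 xD(2) nc'] .
      have n': "near e2 e1" "near e3 e1"
        using n near_sym by blast+
      obtain q q' where "e2 - e1 = {q, q'}" "q \<noteq> q'"
        using near_Diff[OF E(2,1) n'(1)] .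
      then obtain y' where y': "e2 - e1 = {y, y'}" "y \<noteq> y'"
        using y(1) by auto
      obtain q q' where "e3 - e1 = {q, q'}" "q \<noteq> q'"
        using near_Diff[OF E(3,1) n'(2)] .
      then obtain z' where z': "e3 - e1 = {z, z'}" "z \<noteq> z'"
        using z(1) by auto
      have "e2 = (e1 \<inter> e2) \<union> (e2 - e1)" "e3 = (e1 \<inter> e3) \<union> (e3 - e1)"
        by auto
      then have e: "e2 = {c, y, y'}" "e3 = {b, z, z'}"
        unfolding c b y' z' by auto
      have m: "y \<in> e2 - e1" "y' \<in> e2 - e1" "z \<in> e3 - e1" "z' \<in> e3 - e1"
        unfolding y' z' by simp_all
      have H: "{x, c, y} \<in> E" "{x, c, y'} \<in> E" "{x, b, z} \<in> E" "{x, b, z'} \<in> E"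
        using z(5) y(5) m by simp_all
      have "distinct [x, b, c, y, y', z, z']"
        using m x bc y'(2) z'(2) i3(1) by auto
      from cov_crossing[OF t x(1) e this H z(2-4) y(2-4) pr]
      show False
        using not6 by contradiction
    qed
  qed
qed

end

section \<open>The bound\<close>

context no_four
begin

definition near_pairs :: "'a set \<Rightarrow> 'a set \<Rightarrow> 'a set \<Rightarrow> nat" where
  "near_pairs a b c = of_bool (near a b) + of_bool (near a c) + of_bool (near b c)"

lemma cov_E:
  assumes "trip a b c"
  shows "cov E (3 * h)"
proof -
  have triples: "no_four_triples k E" if "k = 3"
    using that by unfold_locales
  have perm: "trip y x z" "trip x z y" "trip z x y" "trip y z x" if "trip x y z" for x y z
    using that trip_perm[OF that] trip_perm(1)[OF trip_perm(2)[OF that]] trip_perm(2)[OF trip_perm(1)[OF that]]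
    by simp_all
  define n where "n = (LEAST m. \<exists>a b c. trip a b c \<and> near_pairs a b c = m)"
  have "\<exists>m. \<exists>a b c. trip a b c \<and> near_pairs a b c = m"
    using assms by blast
  then have "\<exists>a b c. trip a b c \<and> near_pairs a b c = n"
    unfolding n_def by (rule LeastI_ex)
  then obtain a b c where t: "trip a b c" and eq: "near_pairs a b c = n"
    by blast
  have least: "near_pairs a b c \<le> near_pairs x y z" if "trip x y z" for x y z
    unfolding eq unfolding n_def using that by (intro Least_le) blast
  \<comment> \<open>If even the minimum is 2, every independent triple has at most one pair that is
    not near, so each edge is near one of the others.\<close>
  have two: "near x y \<or> near x z" if "2 \<le> near_pairs a b c" "trip x y z" for x y z
    using least[OF that(2)] that(1) by (cases "near x y"; cases "near x z"; cases "near y z") (auto simp: near_pairs_def)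
  have go: "cov E (3 * h)"
    if "trip x y z" "near x y" "near x z" "\<not> near y z" "2 \<le> near_pairs a b c" for x y z
  proof (cases "k = 3")
    case True
    interpret no_four_triples k E
      by (rule triples[OF True])
    show ?thesis
      using cov_two_near_triples[OF that(1-4) two[OF that(5)]] by (simp add: h_eq)
  next
    case False
    then have "4 \<le> k"
      using k3 by simp
    note go_two = two[OF that(5)]
    note \<open>4 \<le> k\<close>
    moreover have "near f y \<and> near f z" if f: "f \<in> priv x y z" for f
    proof -
      have "trip f y z"
        using f \<open>trip x y z\<close> by (auto simp: priv_def trip_def)
      then have "trip y f z" "trip z f y"
        using perm by blast+
      then show ?thesis
        using go_two \<open>\<not> near y z\<close> near_sym by metis
    qed
    ultimately show ?thesis
      using cov_two_near that(1-4) by blast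
  qed
  consider "near a b" "near a c" "near b c" | "near a b" "near a c" "\<not> near b c"
    | "near a b" "\<not> near a c" "near b c" | "\<not> near a b" "near a c" "near b c"
    | "near a b" "\<not> near a c" "\<not> near b c" | "\<not> near a b" "near a c" "\<not> near b c"
    | "\<not> near a b" "\<not> near a c" "near b c" | "\<not> near a b" "\<not> near a c" "\<not> near b c"
    by blast
  then show ?thesis
  proof cases
    case 1
    \<comment> \<open>The minimum is 3 here, so every pair in every independent triple is
      near.\<close>
    have all: "near x y" if "trip x y z" for x y z
      using least[OF that] 1 by (cases "near x y"; cases "near x z"; cases "near y z") (auto simp: near_pairs_def)
    show ?thesis
    proof (cases "k = 3")
      case True
      interpret no_four_triples k E
        by (rule triples[OF True])
      show ?thesis
        using cov_three_near_triples[OF t all] by (simp add: h_eq)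
    next
      case False
      then show ?thesis
        using cov_three_near[OF _ t 1 all] k3 by simp
    qed
  next
    case 2
    then show ?thesis
      using go[OF t] by (simp add: near_pairs_def)
  next
    case 3
    then show ?thesis
      using go[OF perm(1)[OF t]] near_sym by (simp add: near_pairs_def)
  next
    case 4
    then show ?thesis
      using go[OF perm(3)[OF t]] near_sym by (simp add: near_pairs_def)
  next
    case 5
    then show ?thesis
      using cov_one_near[OF t] by simp
  next
    case 6
    then show ?thesis
      using cov_one_near[OF perm(2)[OF t]] near_sym by simp
  next
    case 7
    then show ?thesis
      using cov_one_near[OF perm(4)[OF t]] near_sym by simp
  next
    case 8
    then show ?thesis
      using cov_no_near[OF t] by simp
  qed
qed

end

theorem theorem2:
  fixes k :: nat and V :: "'a set" and E :: "'a set set"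
  assumes "k \<ge> 3"
    and "finite V"
    and "uniform_hypergraph k V E"
    and "matching_number (k - 1) E = 3"
  shows "int (cover_number (k - 1) V E) \<le> 3 * \<lceil>(real k + 1) / 2\<rceil>"
proof -
  have sub: "e \<subseteq> V" "finite e" "card e = k" if "e \<in> E" for e
    using assms(3) that by (auto simp: uniform_hypergraph_def)
  have "finite E"
    using assms(2) sub(1) by (meson Pow_iff finite_Pow_iff finite_subset subsetI)
  interpret uniform_family k E
    using assms(1) sub \<open>finite E\<close> by unfold_locales auto
  note sizes = matching_sizes_finite_nonempty[OF assms(2,3), of "k - 1"]
  have max3: "card M \<le> 3" if "m_matching (k - 1) E M" for M
  proof -
    have "card M \<le> Max {card M | M. m_matching (k - 1) E M}"
      using sizes that by (intro Max_ge) auto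
    then show ?thesis
      using assms(4) by (simp add: matching_number_def)
  qed
  have "matching_number (k - 1) E \<in> {card M | M. m_matching (k - 1) E M}"
    unfolding matching_number_def using sizes by (rule Max_in)
  then obtain M where M: "m_matching (k - 1) E M" "card M = 3"
    using assms(4) by auto
  have ind_iff: "card (e \<inter> f) < k - 1 \<longleftrightarrow> ind e f" for e f
    using assms(1) by (auto simp: ind_def)
  interpret no_four k E
  proof
    fix a b c d
    assume abcd: "a \<in> E" "b \<in> E" "c \<in> E" "d \<in> E" "ind a b" "ind a c" "ind a d" "ind b c" "ind b d" "ind c d"
    then have "a \<noteq> b" "a \<noteq> c" "a \<noteq> d" "b \<noteq> c" "b \<noteq> d" "c \<noteq> d"
      using not_ind_self by blast+
    then have "card {a, b, c, d} = 4"
      by simp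
    moreover have "m_matching (k - 1) E {a, b, c, d}"
      using abcd unfolding m_matching_def ind_iff by (auto simp: ind_sym)
    ultimately show False
      using max3[of "{a, b, c, d}"] by simp
  qed
  obtain a b c where "M = {a, b, c}" "a \<noteq> b" "a \<noteq> c" "b \<noteq> c"
    using M(2) by (auto simp: card_3_iff)
  then have "trip a b c"
    using M(1) unfolding m_matching_def ind_iff trip_def by auto
  then have "cov E (3 * h)"
    by (rule cov_E)
  then obtain C where C: "finite C" "card C \<le> 3 * h" "\<forall>S\<in>C. k \<le> Suc (card S)" "\<forall>f\<in>E. \<exists>S\<in>C. S \<subseteq> f"
    unfolding cov_def by blast
  \<comment> \<open>\<open>cov\<close> allows sets that are larger or stick out of \<open>V\<close>.
    They are shrunk to \<open>k - 1\<close> elements, and those not inside \<open>V\<close> are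
    discarded, since no edge contains them.\<close>
  have "\<exists>T\<subseteq>S. card T = k - 1" if "S \<in> C" for S
  proof -
    have "k - 1 \<le> card S"
      using C(3) that by fastforce
    then show ?thesis
      by (metis obtain_subset_with_card_n)
  qed
  then obtain T where T: "\<And>S. S \<in> C \<Longrightarrow> T S \<subseteq> S \<and> card (T S) = k - 1"
    by metis
  define D where "D = {S \<in> T ` C. S \<subseteq> V}"
  have "m_cover (k - 1) V E D"
    unfolding m_cover_def
  proof (intro conjI ballI)
    show "D \<subseteq> {S. S \<subseteq> V \<and> finite S \<and> card S = k - 1}"
      using T assms(2) finite_subset by (auto simp: D_def)
    fix e assume e: "e \<in> E"
    then obtain S where "S \<in> C" "S \<subseteq> e"
      using C(4) by blast
    then show "\<exists>S\<in>D. S \<subseteq> e"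
      using T[of S] sub(1)[OF e] unfolding D_def by (intro bexI[of _ "T S"]) auto
  qed
  moreover have "card D \<le> 3 * h"
  proof -
    have "card D \<le> card (T ` C)"
      using C(1) by (intro card_mono) (auto simp: D_def)
    also have "\<dots> \<le> card C"
      using C(1) by (rule card_image_le)
    finally show ?thesis
      using C(2) by simp
  qed
  moreover have "cover_number (k - 1) V E \<le> card D"
    unfolding cover_number_def
    using cover_sizes_finite_nonempty(1)[OF assms(2,3), of "k - 1"] \<open>m_cover (k - 1) V E D\<close>
    by (intro Min_le) auto
  ultimately have "cover_number (k - 1) V E \<le> 3 * h"
    by simp
  moreover have "int h = \<lceil>(real k + 1) / 2\<rceil>"
  proof -
    have "\<lceil>(real k + 1) / 2\<rceil> = \<lceil>real_of_int (int k + 1) / real_of_int 2\<rceil>"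
      by simp
    also have "\<dots> = - (- (int k + 1) div 2)"
      by (rule ceiling_divide_eq_div)
    also have "\<dots> = int h"
      unfolding h_def by (simp add: zdiv_int)
    finally show ?thesis
      by simp
  qed
  ultimately show ?thesis
    by linarith
qed

end
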